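(* Let $m\ge1$. There exists a unique compact magic hypercube of order $4$ and dimension $m$ (with entries $1,\ldots,4^m$) up to the natural faithful action of the group $\mathrm{Aut}(FQ_{2m})\cong C_2^{2m}\rtimes S_{2m+1}$; that is, the set of such hypercubes is nonempty and forms a single orbit under this faithful action.
   Context: A compact magic hypercube of order $4$ and dimension $m$ is an arrangement of the numbers $1,2,\ldots,4^m$ in a $4\times\cdots\times4$ ($m$-fold) grid, with positions indexed by $(\mathbb Z/4\mathbb Z)^m$, such that all orthogonal lines (four positions obtained by fixing all but one coordinate) and all $2\times2$ subsquares (positions obtained by fixing all but two coordinates and letting those two range over $\{i,i+1\}\times\{k,k+1\}$ modulo $4$, so wrap-around subsquares are included) sum to the same magic constant. $Q_{2m}$ is the hypercube graph on $\{0,1\}^{2m}$, and the folded hypercube graph $FQ_{2m}$ is $Q_{2m}$ together with an edge joining each pair of antipodal vertices (vertices differing in all coordinates). $C_4^m$ is the $m$-fold Cartesian product of the $4$-cycle $C_4$, i.e. the toroidal grid graph on the positions; since $C_4\cong K_2\times K_2$, there is a graph isomorphism $C_4^m\cong Q_{2m}$, which is fixed. The natural action is: $\mathrm{Aut}(FQ_{2m})$ permutes the vertices of $FQ_{2m}$, which are the vertices of $Q_{2m}$, hence via the isomorphism permutes the positions $(\mathbb Z/4\mathbb Z)^m$ of the grid, and thus acts on arrangements. In $C_2^{2m}\rtimes S_{2m+1}$, $C_2^{2m}$ is identified with $\mathbb F_2^{2m+1}/\langle e_0+\cdots+e_{2m}\rangle$ and $S_{2m+1}$ permutes $e_0,\ldots,e_{2m}$.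 *)

theory Defs
  imports "HOL-Algebra.Algebra"
begin

section \<open>Compact magic hypercubes of order 4\<close>

text \<open>Positions are the elements of $(\mathbb{Z}/4\mathbb{Z})^m$, residues being
  represented by $0,1,2,3$.  The functions are extensional, so that distinct functions
  are distinct positions.\<close>

definition positions :: "nat \<Rightarrow> (nat \<Rightarrow> nat) set"
  where "positions m = {..<m} \<rightarrow>\<^sub>E {..<4}"

definition arrangements :: "nat \<Rightarrow> ((nat \<Rightarrow> nat) \<Rightarrow> nat) set"
  where "arrangements m =
    {A \<in> extensional (positions m). bij_betw A (positions m) {1..4 ^ m}}"

definition orthogonal_lines :: "nat \<Rightarrow> (nat \<Rightarrow> nat) set set"
  where "orthogonal_lines m =
    {{p(j := x) | x. x < 4} | p j. p \<in> positions m \<and> j < m}"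

definition subsquares :: "nat \<Rightarrow> (nat \<Rightarrow> nat) set set"
  where "subsquares m =
    {{p(j := x, k := y) | x y. x \<in> {a, (a + 1) mod 4} \<and> y \<in> {b, (b + 1) mod 4}}
      | p j k a b. p \<in> positions m \<and> j < m \<and> k < m \<and> j \<noteq> k \<and> a < 4 \<and> b < 4}"

definition compact_magic_hypercubes :: "nat \<Rightarrow> ((nat \<Rightarrow> nat) \<Rightarrow> nat) set"
  where "compact_magic_hypercubes m =
    {A \<in> arrangements m. \<exists>c. \<forall>S \<in> orthogonal_lines m \<union> subsquares m. sum A S = c}"


section \<open>Graphs\<close>

record 'a ugraph =
  verts :: "'a set"
  edges :: "'a set set"

definition graph_iso :: "'a ugraph \<Rightarrow> 'b ugraph \<Rightarrow> ('a \<Rightarrow> 'b) \<Rightarrow> bool"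
  where "graph_iso G H f \<longleftrightarrow>
    bij_betw f (verts G) (verts H) \<and>
    (\<forall>u \<in> verts G. \<forall>v \<in> verts G. {u, v} \<in> edges G \<longleftrightarrow> {f u, f v} \<in> edges H)"

definition Aut :: "'a ugraph \<Rightarrow> ('a \<Rightarrow> 'a) monoid"
  where "Aut G = BijGroup (verts G) \<lparr>carrier := {f \<in> Bij (verts G). graph_iso G G f}\<rparr>"

definition cartesian_power :: "nat \<Rightarrow> 'a ugraph \<Rightarrow> (nat \<Rightarrow> 'a) ugraph"
  where "cartesian_power n G =
    \<lparr>verts = {..<n} \<rightarrow>\<^sub>E verts G,
     edges = {{p, q} | p q. p \<in> {..<n} \<rightarrow>\<^sub>E verts G \<and> q \<in> {..<n} \<rightarrow>\<^sub>E verts G \<and>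
       (\<exists>j<n. {p j, q j} \<in> edges G \<and> (\<forall>i<n. i \<noteq> j \<longrightarrow> p i = q i))}\<rparr>"

definition cycle4 :: "nat ugraph"
  where "cycle4 = \<lparr>verts = {..<4}, edges = {{x, (x + 1) mod 4} | x. x < 4}\<rparr>"

definition hypercube :: "nat \<Rightarrow> (nat \<Rightarrow> nat) ugraph"
  where "hypercube n =
    \<lparr>verts = {..<n} \<rightarrow>\<^sub>E {0, 1},
     edges = {{u, v} | u v. u \<in> {..<n} \<rightarrow>\<^sub>E {0, 1} \<and> v \<in> {..<n} \<rightarrow>\<^sub>E {0, 1} \<and>
       (\<exists>!i. i < n \<and> u i \<noteq> v i)}\<rparr>"

definition folded_hypercube :: "nat \<Rightarrow> (nat \<Rightarrow> nat) ugraph"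
  where "folded_hypercube n =
    \<lparr>verts = verts (hypercube n),
     edges = edges (hypercube n) \<union>
       {{u, v} | u v. u \<in> verts (hypercube n) \<and> v \<in> verts (hypercube n) \<and>
         (\<forall>i<n. u i \<noteq> v i)}\<rparr>"


section \<open>The action on arrangements\<close>

text \<open>For a bijection \<open>\<phi>\<close> from the positions to the vertices of the hypercube, a vertex
  permutation \<open>g\<close> moves position \<open>p\<close> to position $\phi^{-1}(g(\phi(p)))$, and it carries the
  entry at \<open>p\<close> along; the entry of the new arrangement at \<open>p\<close> is therefore the old entry at
  the preimage of \<open>p\<close>, which makes this a left action.\<close>

definition position_perm ::
    "nat \<Rightarrow> ((nat \<Rightarrow> nat) \<Rightarrow> (nat \<Rightarrow> nat)) \<Rightarrow> ((nat \<Rightarrow> nat) \<Rightarrow> (nat \<Rightarrow> nat)) \<Rightarrow>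
      (nat \<Rightarrow> nat) \<Rightarrow> (nat \<Rightarrow> nat)"
  where "position_perm m \<phi> g = (\<lambda>p \<in> positions m. inv_into (positions m) \<phi> (g (\<phi> p)))"

text \<open>The action is restricted to a set \<open>E\<close> of arrangements because the locale of group
  actions on \<open>E\<close> asks for extensional permutations of \<open>E\<close>.\<close>

definition arrangement_action ::
    "nat \<Rightarrow> ((nat \<Rightarrow> nat) \<Rightarrow> (nat \<Rightarrow> nat)) \<Rightarrow> ((nat \<Rightarrow> nat) \<Rightarrow> nat) set \<Rightarrow>
      ((nat \<Rightarrow> nat) \<Rightarrow> (nat \<Rightarrow> nat)) \<Rightarrow> ((nat \<Rightarrow> nat) \<Rightarrow> nat) \<Rightarrow> ((nat \<Rightarrow> nat) \<Rightarrow> nat)"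
  where "arrangement_action m \<phi> E g =
    (\<lambda>A \<in> E. \<lambda>p \<in> positions m. A (inv_into (positions m) (position_perm m \<phi> g) p))"


section \<open>The semidirect product\<close>

definition semidirect_product ::
    "('a, 'c) monoid_scheme \<Rightarrow> ('b, 'd) monoid_scheme \<Rightarrow> ('b \<Rightarrow> 'a \<Rightarrow> 'a) \<Rightarrow> ('a \<times> 'b) monoid"
  where "semidirect_product N H \<theta> =
    \<lparr>carrier = carrier N \<times> carrier H,
     monoid.mult = (\<lambda>(a, h) (b, k). (a \<otimes>\<^bsub>N\<^esub> \<theta> h b, h \<otimes>\<^bsub>H\<^esub> k)),
     one = (\<one>\<^bsub>N\<^esub>, \<one>\<^bsub>H\<^esub>)\<rparr>"

text \<open>The additive group of $\mathbb{F}_2^{2m+1}$ with basis $e_0,\dots,e_{2m}$, and its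
  quotient by the subgroup spanned by $e_0+\dots+e_{2m}$.\<close>

definition F2_space :: "nat \<Rightarrow> (nat \<Rightarrow> int) monoid"
  where "F2_space m = product_group {0..2 * m} (\<lambda>_. integer_mod_group 2)"

definition basis_vec :: "nat \<Rightarrow> nat \<Rightarrow> (nat \<Rightarrow> int)"
  where "basis_vec m i = (\<lambda>j \<in> {0..2 * m}. if j = i then 1 else 0)"

definition F2_quotient :: "nat \<Rightarrow> (nat \<Rightarrow> int) set monoid"
  where "F2_quotient m =
    F2_space m Mod generate (F2_space m) {finprod (F2_space m) (basis_vec m) {0..2 * m}}"

text \<open>The linear map sending $e_i$ to $e_{\sigma(i)}$ sends \<open>v\<close> to $v \circ \sigma^{-1}$.
  Elements of the quotient are cosets, on which the map acts by taking images.\<close>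

definition perm_vec :: "nat \<Rightarrow> (nat \<Rightarrow> nat) \<Rightarrow> (nat \<Rightarrow> int) \<Rightarrow> (nat \<Rightarrow> int)"
  where "perm_vec m \<sigma> v = (\<lambda>i \<in> {0..2 * m}. v (inv_into {0..2 * m} \<sigma> i))"

definition C2_semidirect_Sym :: "nat \<Rightarrow> ((nat \<Rightarrow> int) set \<times> (nat \<Rightarrow> nat)) monoid"
  where "C2_semidirect_Sym m =
    semidirect_product (F2_quotient m) (BijGroup {0..2 * m}) (\<lambda>\<sigma> C. perm_vec m \<sigma> ` C)"


section \<open>The toroidal grid graph is a hypercube\<close>

definition hi :: "nat \<Rightarrow> nat" where "hi x = (if x = 2 \<or> x = 3 then 1 else 0)"
definition lo :: "nat \<Rightarrow> nat" where "lo x = (if x = 1 \<or> x = 2 then 1 else 0)"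

text \<open>The Gray code realises $C_4 \cong K_2 \times K_2$ in each coordinate.\<close>

definition gray :: "nat \<Rightarrow> (nat \<Rightarrow> nat) \<Rightarrow> (nat \<Rightarrow> nat)"
  where "gray m p = (\<lambda>i \<in> {..<2 * m}. if even i then hi (p (i div 2)) else lo (p (i div 2)))"

lemma less4: "x < (4::nat) \<longleftrightarrow> x = 0 \<or> x = 1 \<or> x = 2 \<or> x = 3"
  by auto

lemma hi_lo_inj: "x < 4 \<Longrightarrow> y < 4 \<Longrightarrow> hi x = hi y \<Longrightarrow> lo x = lo y \<Longrightarrow> x = y"
  by (auto simp: hi_def lo_def less4)

lemma hi_lo_surj:
  assumes "a \<in> {0, 1}" "b \<in> {0, 1}"
  shows "\<exists>x<4. hi x = a \<and> lo x = b"
proof -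
  consider "a = 0" "b = 0" | "a = 0" "b = 1" | "a = 1" "b = 1" | "a = 1" "b = 0"
    using assms by auto
  then show ?thesis
  proof cases
    case 1 then show ?thesis by (intro exI[of _ 0]) (simp add: hi_def lo_def)
  next
    case 2 then show ?thesis by (intro exI[of _ 1]) (simp add: hi_def lo_def)
  next
    case 3 then show ?thesis by (intro exI[of _ 2]) (simp add: hi_def lo_def)
  next
    case 4 then show ?thesis by (intro exI[of _ 3]) (simp add: hi_def lo_def)
  qed
qed

lemma cycle4_edges:
  "edges cycle4 = {{0, 1}, {1, 2}, {2, 3}, {3, 0}}"
proof -
  have "edges cycle4 = (\<lambda>x. {x, (x + 1) mod 4}) ` {..<4}"
    by (auto simp: cycle4_def)
  also have "{..<4} = {0, 1, 2, 3 :: nat}" by auto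
  finally have "edges cycle4 = (\<lambda>x. {x, (x + 1) mod 4}) ` {0, 1, 2, 3}" .
  moreover have "(0 + 1) mod 4 = (1::nat)" "(1 + 1) mod 4 = (2::nat)"
    "(2 + 1) mod 4 = (3::nat)" "(3 + 1) mod 4 = (0::nat)"
    by simp_all
  ultimately show ?thesis by (simp only: image_insert image_empty)
qed

lemma cycle4_adj:
  assumes "x < 4" "y < 4"
  shows "{x, y} \<in> edges cycle4 \<longleftrightarrow> (hi x \<noteq> hi y) \<noteq> (lo x \<noteq> lo y)"
  using assms unfolding cycle4_edges less4
  by (elim disjE) (simp_all add: hi_def lo_def doubleton_eq_iff)

lemma gray_even: "j < m \<Longrightarrow> gray m p (2 * j) = hi (p j)"
  by (simp add: gray_def)

lemma gray_odd: "j < m \<Longrightarrow> gray m p (Suc (2 * j)) = lo (p j)"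
  by (simp add: gray_def)

lemma half_cases:
  assumes "i < 2 * (m::nat)"
  obtains j where "j < m" "i = 2 * j" | j where "j < m" "i = Suc (2 * j)"
  using assms by (cases "even i") (auto elim!: evenE oddE)

lemma gray_bij: "bij_betw (gray m) (positions m) ({..<2 * m} \<rightarrow>\<^sub>E {0, 1})"
  unfolding bij_betw_def
proof
  show "inj_on (gray m) (positions m)"
  proof (rule inj_onI)
    fix p q assume p: "p \<in> positions m" and q: "q \<in> positions m" and e: "gray m p = gray m q"
    show "p = q"
    proof (rule PiE_ext)
      show "p \<in> {..<m} \<rightarrow>\<^sub>E {..<4}" "q \<in> {..<m} \<rightarrow>\<^sub>E {..<4}"
        using p q by (simp_all add: positions_def)
      fix j assume j: "j \<in> {..<m}"
      have "p j < 4" "q j < 4"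
        using p q j by (auto simp: positions_def)
      then show "p j = q j"
        using j e by (metis gray_even gray_odd hi_lo_inj lessThan_iff)
    qed
  qed
  show "gray m ` positions m = ({..<2 * m} \<rightarrow>\<^sub>E {0, 1})"
  proof
    show "gray m ` positions m \<subseteq> ({..<2 * m} \<rightarrow>\<^sub>E {0, 1})"
    proof
      fix u assume "u \<in> gray m ` positions m"
      then obtain p where u: "u = gray m p" by blast
      show "u \<in> {..<2 * m} \<rightarrow>\<^sub>E {0, 1}"
        unfolding u gray_def
      proof (rule restrict_PiE_iff[THEN iffD2], rule ballI)
        fix i
        show "(if even i then hi (p (i div 2)) else lo (p (i div 2))) \<in> {0, 1}"
          by (simp add: hi_def lo_def)
      qed
    qed
    show "({..<2 * m} \<rightarrow>\<^sub>E {0, 1}) \<subseteq> gray m ` positions m"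
    proof
      fix u :: "nat \<Rightarrow> nat" assume u: "u \<in> {..<2 * m} \<rightarrow>\<^sub>E {0, 1}"
      have "\<exists>x<4. hi x = u (2 * j) \<and> lo x = u (Suc (2 * j))" if "j < m" for j
      proof (rule hi_lo_surj)
        have "2 * j \<in> {..<2 * m}" "Suc (2 * j) \<in> {..<2 * m}" using that by auto
        then show "u (2 * j) \<in> {0, 1}" "u (Suc (2 * j)) \<in> {0, 1}"
          using PiE_mem[OF u] by blast+
      qed
      then obtain f where f: "\<And>j. j < m \<Longrightarrow> f j < 4 \<and> hi (f j) = u (2 * j) \<and> lo (f j) = u (Suc (2 * j))"
        by metis
      define p where "p = restrict f {..<m}"
      have p: "p \<in> positions m" using f by (auto simp: p_def positions_def)
      have "gray m p = u"
      proof (rule extensionalityI[of _ "{..<2 * m}"])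
        show "gray m p \<in> extensional {..<2 * m}" by (simp add: gray_def)
        show "u \<in> extensional {..<2 * m}" using u by (simp add: PiE_def)
        fix i assume "i \<in> {..<2 * m}"
        then have "i < 2 * m" by simp
        then show "gray m p i = u i"
          by (cases rule: half_cases) (auto simp: gray_even gray_odd p_def f)
      qed
      with p show "u \<in> gray m ` positions m" by blast
    qed
  qed
qed

lemma gray_adj:
  assumes p: "p \<in> positions m" and q: "q \<in> positions m"
  shows "(\<exists>j<m. {p j, q j} \<in> edges cycle4 \<and> (\<forall>i<m. i \<noteq> j \<longrightarrow> p i = q i)) \<longleftrightarrow>
    (\<exists>!i. i < 2 * m \<and> gray m p i \<noteq> gray m q i)" (is "?L \<longleftrightarrow> ?R")
proof
  have lt: "\<And>j. j < m \<Longrightarrow> p j < 4 \<and> q j < 4"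
    using p q by (auto simp: positions_def)
  {
    assume ?L
    then obtain j where j: "j < m" and a: "{p j, q j} \<in> edges cycle4"
      and o: "\<And>i. i < m \<Longrightarrow> i \<noteq> j \<Longrightarrow> p i = q i" by blast
    have d: "i = 2 * j \<or> i = Suc (2 * j)" if "i < 2 * m" "gray m p i \<noteq> gray m q i" for i
      using that(1)
    proof (cases rule: half_cases)
      case (1 k) then show ?thesis using that(2) o[of k] by (cases "k = j") (auto simp: gray_even)
    next
      case (2 k) then show ?thesis using that(2) o[of k] by (cases "k = j") (auto simp: gray_odd)
    qed
    have x: "(gray m p (2 * j) \<noteq> gray m q (2 * j)) \<noteq> (gray m p (Suc (2 * j)) \<noteq> gray m q (Suc (2 * j)))"
      using a lt[OF j] j by (simp add: cycle4_adj gray_even gray_odd)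
    have b: "2 * j < 2 * m" "Suc (2 * j) < 2 * m" using j by auto
    show ?R
    proof (cases "gray m p (2 * j) \<noteq> gray m q (2 * j)")
      case True with x d b show ?thesis by (intro ex1I[of _ "2 * j"]) auto
    next
      case False with x d b show ?thesis by (intro ex1I[of _ "Suc (2 * j)"]) auto
    qed
  }
  {
    assume ?R
    then obtain i where i: "i < 2 * m" and n: "gray m p i \<noteq> gray m q i"
      and u: "\<And>k. k < 2 * m \<Longrightarrow> gray m p k \<noteq> gray m q k \<Longrightarrow> k = i" by blast
    define j where "j = i div 2"
    have j: "j < m" using i by (simp add: j_def)
    have ij: "i = 2 * j \<or> i = Suc (2 * j)" by (auto simp: j_def)
    have b: "2 * k < 2 * m" "Suc (2 * k) < 2 * m" if "k < m" for k using that by auto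
    have "p k = q k" if "k < m" "k \<noteq> j" for k
    proof (rule hi_lo_inj)
      show "p k < 4" "q k < 4" using lt that by auto
      have "2 * k \<noteq> i" "Suc (2 * k) \<noteq> i" using that ij by presburger+
      then show "hi (p k) = hi (q k)" "lo (p k) = lo (q k)"
        using u b that by (metis gray_even, metis gray_odd)
    qed
    moreover have "{p j, q j} \<in> edges cycle4"
    proof -
      have e: "gray m p (2 * j) = hi (p j)" "gray m q (2 * j) = hi (q j)"
        "gray m p (Suc (2 * j)) = lo (p j)" "gray m q (Suc (2 * j)) = lo (q j)"
        using j by (simp_all add: gray_even gray_odd)
      have "(hi (p j) \<noteq> hi (q j)) \<noteq> (lo (p j) \<noteq> lo (q j))"
        using ij n u[of "2 * j"] u[of "Suc (2 * j)"] b[OF j] e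
        by (cases "hi (p j) = hi (q j)") auto
      then show ?thesis using lt[OF j] by (simp add: cycle4_adj)
    qed
    ultimately show ?L using j by blast
  }
qed

lemma grid_hypercube_iso:
  "graph_iso (cartesian_power m cycle4) (hypercube (2 * m)) (gray m)"
proof -
  have V: "verts (cartesian_power m cycle4) = positions m"
    by (simp add: cartesian_power_def cycle4_def positions_def)
  have W: "verts (hypercube (2 * m)) = ({..<2 * m} \<rightarrow>\<^sub>E {0, 1})"
    by (simp add: hypercube_def)
  have E: "{p, q} \<in> edges (cartesian_power m cycle4) \<longleftrightarrow>
      (\<exists>j<m. {p j, q j} \<in> edges cycle4 \<and> (\<forall>i<m. i \<noteq> j \<longrightarrow> p i = q i))" (is "_ \<longleftrightarrow> ?P p q")
    if "p \<in> positions m" "q \<in> positions m" for p q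
  proof -
    have "{..<m} \<rightarrow>\<^sub>E verts cycle4 = positions m" by (simp add: positions_def cycle4_def)
    moreover have "?P q' p' \<Longrightarrow> ?P p' q'" for p' q' :: "nat \<Rightarrow> nat"
      by (metis insert_commute)
    ultimately show ?thesis
      using that unfolding cartesian_power_def by (simp add: doubleton_eq_iff) blast
  qed
  have F: "{u, v} \<in> edges (hypercube (2 * m)) \<longleftrightarrow> (\<exists>!i. i < 2 * m \<and> u i \<noteq> v i)"
    if "u \<in> {..<2 * m} \<rightarrow>\<^sub>E {0, 1}" "v \<in> {..<2 * m} \<rightarrow>\<^sub>E {0, 1}" for u v :: "nat \<Rightarrow> nat"
  proof -
    have sym: "\<exists>!i. i < 2 * m \<and> v' i \<noteq> u' i" if "\<exists>!i. i < 2 * m \<and> u' i \<noteq> v' i"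
      for u' v' :: "nat \<Rightarrow> nat"
    proof -
      have "(\<lambda>i. i < 2 * m \<and> v' i \<noteq> u' i) = (\<lambda>i. i < 2 * m \<and> u' i \<noteq> v' i)"
        by auto
      then show ?thesis using that by simp
    qed
    show ?thesis
    proof
      assume "{u, v} \<in> edges (hypercube (2 * m))"
      then obtain u' v' where "{u, v} = {u', v'}" and x: "\<exists>!i. i < 2 * m \<and> u' i \<noteq> v' i"
        unfolding hypercube_def ugraph.simps mem_Collect_eq by metis
      then have "u = u' \<and> v = v' \<or> u = v' \<and> v = u'" by (simp only: doubleton_eq_iff)
      then show "\<exists>!i. i < 2 * m \<and> u i \<noteq> v i"
      proof
        assume "u = u' \<and> v = v'" then show ?thesis using x by simp
      next
        assume "u = v' \<and> v = u'" then show ?thesis using sym[OF x] by simp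
      qed
    next
      assume "\<exists>!i. i < 2 * m \<and> u i \<noteq> v i"
      with that show "{u, v} \<in> edges (hypercube (2 * m))"
        unfolding hypercube_def ugraph.simps mem_Collect_eq
        by - (rule exI[of _ u], rule exI[of _ v], intro conjI refl)
    qed
  qed
  show ?thesis
    unfolding graph_iso_def V W
  proof (intro conjI ballI)
    show "bij_betw (gray m) (positions m) ({..<2 * m} \<rightarrow>\<^sub>E {0, 1})" by (rule gray_bij)
    fix p q assume pq: "p \<in> positions m" "q \<in> positions m"
    then have "gray m p \<in> {..<2 * m} \<rightarrow>\<^sub>E {0, 1}" "gray m q \<in> {..<2 * m} \<rightarrow>\<^sub>E {0, 1}"
      by (metis bij_betw_apply gray_bij)+
    then show "{p, q} \<in> edges (cartesian_power m cycle4) \<longleftrightarrow>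
        {gray m p, gray m q} \<in> edges (hypercube (2 * m))"
      using E[OF pq] F gray_adj[OF pq] by simp
  qed
qed

end

theory Submission
  imports Defs Complex_Main "HOL-Library.Nat_Bijection"
begin

text \<open>Write $n = 2m$.  The vertices of $FQ_n$ are the elements of $\mathbb{F}_2^{n+1}$ modulo the
  all-ones vector, and every edge, antipodal ones included, changes one of the $n + 1$ coordinates.
  As two vertices at distance two have exactly two common neighbours (for $n \ge 4$), an automorphism
  acts on all the neighbourhoods by one and the same coordinate permutation, so it is
  $x \mapsto a + \tau x$.

  Under the isomorphism $\phi$ the lines and subsquares of the grid, being exactly its 4-cycles, are the
  2-faces of $Q_n$.  If all 2-face sums of $f$ equal $4K$, then $(-1)^{|x|}(f(x) - K)$ has vanishing
  mixed second differences and hence is affine in the coordinates.  In the symmetric model this reads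
  $f(x) = K + \prod_i s_i \cdot \sum_{i \le n} b_i s_i$ with signs $s_i = (-1)^{x_i}$, a form that is
  visibly stable under the automorphisms of $FQ_n$.

  If the values of $f$ are $1, \dots, 2^n$, they are symmetric about $K = (2^n + 1)/2$; as $n + 1$ is odd,
  this symmetry forces some $b_i = 0$.  The remaining signs can then be chosen freely, and the subset
  sums of the $n$ numbers $2|b_i|$ take each of the values $0, \dots, 2^n - 1$ once, so these numbers are
  $1, 2, \dots, 2^{n-1}$.  Hence any two solutions differ by permuting the weights $b_i$ and by
  sign changes, where the zero weight absorbs the parity condition.\<close>

section \<open>Automorphisms of the folded hypercube\<close>

text \<open>The extra coordinate acts as a homogenising variable. On representatives with x_n = 0
  the function found is the product over i < n of s_i, times an affine function c + sum of c_i s_i.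
  For a general representative s_i becomes s_i s_n; as n is even, the product becomes s_n times the
  full product over i \<le> n, and this factor s_n turns c + sum of c_i s_i s_n into c s_n + sum of
  c_i s_i. The constant term is thus the weight of the antipodal direction and stands on an equal
  footing with the others. This form is indispensable for invariance: an automorphism of FQ_n may
  exchange an ordinary direction with the antipodal one and need not preserve the 2-faces of Q_n, so
  the magic property cannot simply be transported face by face. The recurring obstacle is that a
  class has two complementary representatives. Since n + 1 is odd their full products are opposite,
  so requiring product 1 selects one of them, and all counting is done on these.\<close>

text \<open>The class of \<open>x\<close> modulo the all-ones vector is represented by the vector of differences
  $x_i + x_n$ with $i < n$; flipping $x_n$ gives the antipodal vertex.\<close>

definition cls :: "nat \<Rightarrow> (nat \<Rightarrow> bool) \<Rightarrow> nat \<Rightarrow> nat"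
  where "cls n x = (\<lambda>i\<in>{..<n}. if x i = x n then 0 else 1)"

definition flip :: "nat \<Rightarrow> (nat \<Rightarrow> bool) \<Rightarrow> nat \<Rightarrow> bool"
  where "flip k x = (\<lambda>i. x i \<noteq> (i = k))"

lemma flip_flip [simp]: "flip k (flip k x) = x"
  by (auto simp: flip_def)

lemma flip_commute: "flip k (flip l x) = flip l (flip k x)"
  by (auto simp: flip_def)

lemma verts_hypercube: "verts (hypercube n) = {..<n} \<rightarrow>\<^sub>E {0, 1}"
  by (simp add: hypercube_def)

lemma verts_folded_hypercube [simp]: "verts (folded_hypercube n) = verts (hypercube n)"
  by (simp add: folded_hypercube_def)

lemma finite_verts_hypercube: "finite (verts (hypercube n))"
  by (simp add: verts_hypercube finite_PiE)

lemma card_verts_hypercube: "card (verts (hypercube n)) = 2 ^ n"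
  by (simp add: verts_hypercube card_PiE numeral_2_eq_2)

lemma cls_in_verts [simp]: "cls n x \<in> verts (hypercube n)"
  by (auto simp: verts_hypercube cls_def)

lemma cls_app: "i < n \<Longrightarrow> cls n x i = (if x i = x n then 0 else 1)"
  by (simp add: cls_def)

lemma cls_eq_if_lt:
  "cls n x = cls n y \<longleftrightarrow> (\<forall>i<n. (x i = x n) = (y i = y n))"
proof
  assume "cls n x = cls n y"
  then have "cls n x i = cls n y i" for i by simp
  then show "\<forall>i<n. (x i = x n) = (y i = y n)"
    by (metis cls_app zero_neq_one)
next
  assume "\<forall>i<n. (x i = x n) = (y i = y n)"
  then show "cls n x = cls n y"
    unfolding cls_def by (intro restrict_ext) auto
qed

lemma cls_eq_iff: "cls n x = cls n y \<longleftrightarrow> (\<forall>i\<le>n. x i = y i) \<or> (\<forall>i\<le>n. x i \<noteq> y i)"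
proof -
  have "(\<forall>i\<le>n. P i) \<longleftrightarrow> P n \<and> (\<forall>i<n. P i)" for P :: "nat \<Rightarrow> bool"
    by (auto simp: le_less)
  then show ?thesis
    unfolding cls_eq_if_lt by (cases "x n"; cases "y n"; simp; blast?)
qed

lemma cls_cong: "(\<And>i. i \<le> n \<Longrightarrow> x i = y i) \<Longrightarrow> cls n x = cls n y"
  by (simp add: cls_eq_iff)

text \<open>The conjunct \<open>i < n\<close> makes the representative \<open>False\<close> at
  coordinate \<open>n\<close>, so the differences formed by \<open>cls\<close> are the entries of
  \<open>u\<close> themselves.\<close>

lemma cls_rep:
  assumes "u \<in> verts (hypercube n)"
  shows "cls n (\<lambda>i. i < n \<and> u i = 1) = u"
proof (rule extensionalityI[of _ "{..<n}"])
  show "u \<in> extensional {..<n}" using assms by (simp add: verts_hypercube PiE_def)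
  show "cls n (\<lambda>i. i < n \<and> u i = 1) \<in> extensional {..<n}" by (simp add: cls_def)
  fix i assume "i \<in> {..<n}"
  moreover from this have "u i = 0 \<or> u i = 1" using assms by (auto simp: verts_hypercube)
  ultimately show "cls n (\<lambda>i. i < n \<and> u i = 1) i = u i" by (auto simp: cls_app)
qed

lemma cls_cases:
  assumes "u \<in> verts (hypercube n)"
  obtains x where "u = cls n x"
  using cls_rep[OF assms] by metis

lemma edge_hypercube_iff:
  "{cls n x, cls n y} \<in> edges (hypercube n) \<longleftrightarrow> (\<exists>k<n. cls n y = cls n (flip k x))"
proof -
  have ex1: "(\<exists>!i. i < n \<and> u i \<noteq> v i) \<longleftrightarrow> (\<exists>k<n. \<forall>i<n. (u i \<noteq> v i) = (i = k))"
    for u v :: "nat \<Rightarrow> nat" by metis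
  have "{cls n x, cls n y} \<in> edges (hypercube n) \<longleftrightarrow>
      (\<exists>k<n. \<forall>i<n. (cls n x i \<noteq> cls n y i) = (i = k))"
  proof
    assume "{cls n x, cls n y} \<in> edges (hypercube n)"
    then obtain u v where uv: "{cls n x, cls n y} = {u, v}" "\<exists>!i. i < n \<and> u i \<noteq> v i"
      unfolding hypercube_def ugraph.simps mem_Collect_eq by metis
    from uv(2) obtain k where "k < n" "\<forall>i<n. (u i \<noteq> v i) = (i = k)" unfolding ex1 by blast
    then show "\<exists>k<n. \<forall>i<n. (cls n x i \<noteq> cls n y i) = (i = k)"
      using uv(1) by (metis doubleton_eq_iff)
  next
    assume "\<exists>k<n. \<forall>i<n. (cls n x i \<noteq> cls n y i) = (i = k)"
    then show "{cls n x, cls n y} \<in> edges (hypercube n)"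
      using cls_in_verts[of n x, unfolded verts_hypercube] cls_in_verts[of n y, unfolded verts_hypercube]
      unfolding hypercube_def ugraph.simps mem_Collect_eq ex1
      by - (rule exI[of _ "cls n x"], rule exI[of _ "cls n y"], intro conjI refl)
  qed
  also have "\<dots> \<longleftrightarrow> (\<exists>k<n. cls n y = cls n (flip k x))"
    unfolding cls_eq_if_lt by (intro ex_cong1 conj_cong all_cong1 imp_cong refl)
       (auto simp: cls_app flip_def)
  finally show ?thesis .
qed

lemma edge_folded_hypercube_iff:
  "{cls n x, cls n y} \<in> edges (folded_hypercube n) \<longleftrightarrow> (\<exists>k\<le>n. cls n y = cls n (flip k x))"
proof -
  have "{cls n x, cls n y} \<in> edges (folded_hypercube n) \<longleftrightarrow>
    {cls n x, cls n y} \<in> edges (hypercube n) \<or> (\<forall>i<n. cls n x i \<noteq> cls n y i)"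
    (is "?l \<longleftrightarrow> ?r1 \<or> ?r2")
  proof
    assume ?l
    then consider ?r1 | u v where "{cls n x, cls n y} = {u, v}" "\<forall>i<n. u i \<noteq> v i"
      unfolding folded_hypercube_def ugraph.simps Un_iff mem_Collect_eq by metis
    then show "?r1 \<or> ?r2"
    proof cases
      case 2 then show ?thesis by (metis doubleton_eq_iff)
    qed simp
  next
    assume "?r1 \<or> ?r2"
    then show ?l
    proof
      assume ?r2
      then show ?l
        using cls_in_verts[of n x] cls_in_verts[of n y] unfolding folded_hypercube_def ugraph.simps Un_iff mem_Collect_eq
        by - (rule disjI2, rule exI[of _ "cls n x"], rule exI[of _ "cls n y"], intro conjI refl)
    qed (simp add: folded_hypercube_def)
  qed
  moreover have "?r2 \<longleftrightarrow> cls n y = cls n (flip n x)"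
    unfolding cls_eq_if_lt by (intro all_cong1 imp_cong refl) (auto simp: cls_app flip_def)
  ultimately show ?thesis
    by (auto simp: edge_hypercube_iff le_less)
qed

section \<open>Affine maps of the symmetric model\<close>

definition aff :: "nat \<Rightarrow> (nat \<Rightarrow> bool) \<Rightarrow> (nat \<Rightarrow> nat) \<Rightarrow> (nat \<Rightarrow> nat) \<Rightarrow> nat \<Rightarrow> nat"
  where "aff n a \<tau> = (\<lambda>u\<in>verts (hypercube n). cls n (\<lambda>i. a i \<noteq> (\<tau> i < n \<and> u (\<tau> i) = 1)))"

text \<open>Complementing \<open>x\<close> complements the image vector, so any representative of
  the class may be used, while the definition has to fix the one that is \<open>False\<close> at
  \<open>n\<close>. The permutation acts by precomposition; composing such maps therefore composes
  the permutations in reverse order.\<close>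

lemma aff_cls:
  assumes "bij_betw \<tau> {..n} {..n}"
  shows "aff n a \<tau> (cls n x) = cls n (\<lambda>i. a i \<noteq> x (\<tau> i))"
proof -
  let ?y = "\<lambda>i. i < n \<and> cls n x i = 1"
  have \<tau>: "\<tau> i \<le> n" if "i \<le> n" for i using assms that by (meson atMost_iff bij_betw_apply)
  have "cls n ?y = cls n x" by (rule cls_rep) simp
  then have "(\<forall>i\<le>n. ?y i = x i) \<or> (\<forall>i\<le>n. ?y i \<noteq> x i)"
    by (simp add: cls_eq_iff)
  then have "cls n (\<lambda>i. a i \<noteq> ?y (\<tau> i)) = cls n (\<lambda>i. a i \<noteq> x (\<tau> i))"
    unfolding cls_eq_iff using \<tau> by metis
  then show ?thesis by (simp add: aff_def)
qed

lemma Aut_carrier: "carrier (Aut G) = {f \<in> Bij (verts G). graph_iso G G f}"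
  by (simp add: Aut_def)

text \<open>Flipping coordinate \<open>k\<close> of the image amounts to flipping coordinate
  \<open>\<tau> k\<close> of the argument, and \<open>\<tau>\<close> permutes all
  \<open>n + 1\<close> directions, so edges correspond to edges both ways. Injectivity on the finite
  vertex set gives bijectivity.\<close>

lemma aff_in_Aut:
  assumes \<tau>: "bij_betw \<tau> {..n} {..n}"
  shows "aff n a \<tau> \<in> carrier (Aut (folded_hypercube n))"
proof -
  let ?V = "verts (hypercube n)"
  have onto: "\<exists>i\<le>n. \<tau> i = k" if "k \<le> n" for k
    using \<tau> that by (metis atMost_iff bij_betw_iff_bijections)
  have into: "\<tau> i \<le> n" if "i \<le> n" for i using \<tau> that by (meson atMost_iff bij_betw_apply)
  have inj: "\<tau> i = \<tau> j \<longleftrightarrow> i = j" if "i \<le> n" "j \<le> n" for i j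
    using \<tau> that by (meson atMost_iff bij_betw_imp_inj_on inj_on_eq_iff)
  have eq: "cls n (\<lambda>i. a i \<noteq> x (\<tau> i)) = cls n (\<lambda>i. a i \<noteq> y (\<tau> i)) \<longleftrightarrow> cls n x = cls n y" for x y
  proof -
    have re: "(\<forall>i\<le>n. Q (\<tau> i)) \<longleftrightarrow> (\<forall>i\<le>n. Q i)" for Q using onto into by metis
    have "((b \<noteq> c) = (b \<noteq> d)) = (c = d)" "((b \<noteq> c) \<noteq> (b \<noteq> d)) = (c \<noteq> d)" for b c d :: bool
      by blast+
    then show ?thesis
      unfolding cls_eq_iff re[of "\<lambda>i. x i = y i", symmetric] re[of "\<lambda>i. x i \<noteq> y i", symmetric]
      by (simp only:)
  qed
  have "inj_on (aff n a \<tau>) ?V"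
    by (rule inj_onI, elim cls_cases) (simp only: aff_cls[OF \<tau>] eq)
  moreover have "aff n a \<tau> ` ?V \<subseteq> ?V" by (auto simp: aff_def)
  ultimately have bij: "bij_betw (aff n a \<tau>) ?V ?V"
    by (simp add: bij_betw_def endo_inj_surj finite_verts_hypercube)
  have fl: "cls n (flip k (\<lambda>i. a i \<noteq> x (\<tau> i))) = cls n (\<lambda>i. a i \<noteq> flip (\<tau> k) x (\<tau> i))" if "k \<le> n" for x k
  proof (rule cls_cong)
    fix i assume "i \<le> n"
    then have "(\<tau> i = \<tau> k) = (i = k)" using inj that by blast
    then show "flip k (\<lambda>i. a i \<noteq> x (\<tau> i)) i = (a i \<noteq> flip (\<tau> k) x (\<tau> i))"
      unfolding flip_def by (cases "i = k") simp_all
  qed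
  have "{u, v} \<in> edges (folded_hypercube n) \<longleftrightarrow> {aff n a \<tau> u, aff n a \<tau> v} \<in> edges (folded_hypercube n)"
    if "u \<in> ?V" "v \<in> ?V" for u v
  proof -
    from that obtain x y where xy: "u = cls n x" "v = cls n y" by (elim cls_cases)
    have "{aff n a \<tau> u, aff n a \<tau> v} \<in> edges (folded_hypercube n) \<longleftrightarrow>
       (\<exists>k\<le>n. cls n y = cls n (flip (\<tau> k) x))"
      unfolding xy aff_cls[OF \<tau>] edge_folded_hypercube_iff
      by (intro ex_cong1 conj_cong refl) (simp only: fl eq)
    also have "\<dots> \<longleftrightarrow> (\<exists>k\<le>n. cls n y = cls n (flip k x))" using onto into by metis
    finally show ?thesis by (simp add: xy edge_folded_hypercube_iff)
  qed
  moreover have "aff n a \<tau> \<in> extensional ?V" by (simp add: aff_def)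
  ultimately show ?thesis using bij by (simp add: Aut_carrier Bij_def graph_iso_def)
qed

section \<open>Every automorphism is affine\<close>

lemma Aut_folded_in_verts:
  assumes "g \<in> carrier (Aut (folded_hypercube n))" "u \<in> verts (hypercube n)"
  shows "g u \<in> verts (hypercube n)"
proof -
  have "bij_betw g (verts (hypercube n)) (verts (hypercube n))"
    using assms by (simp add: Aut_carrier Bij_def)
  then show ?thesis using assms(2) by (rule bij_betw_apply)
qed

text \<open>Agreement in one coordinate excludes the complementary case, so an equation of classes
  turns into an equation of vectors. The coordinate \<open>e\<close> is typically one that none of
  the flips involved touches; \<open>ex_le_notin\<close> supplies such a coordinate by
  counting.\<close>

lemma cls_eqD: "cls n x = cls n y \<Longrightarrow> e \<le> n \<Longrightarrow> x e = y e \<Longrightarrow> i \<le> n \<Longrightarrow> x i = y i"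
  unfolding cls_eq_iff by blast

lemma ex_le_notin:
  assumes "finite S" "card S \<le> n"
  obtains e where "e \<le> n" "e \<notin> S"
proof -
  have "\<not> {..n} \<subseteq> S" using assms card_mono[of S "{..n}"] by auto
  then show thesis using that by blast
qed

text \<open>A third coordinate is what tells the two neighbours apart: for \<open>n = 1\<close>
  flipping either one of the two coordinates gives complementary vectors, that is, the same
  class.\<close>

lemma cls_flip_eq_iff:
  assumes "n \<ge> 2" "k \<le> n" "l \<le> n"
  shows "cls n (flip k x) = cls n (flip l x) \<longleftrightarrow> k = l"
proof
  assume eq: "cls n (flip k x) = cls n (flip l x)"
  have "card {k, l} \<le> n" using assms by (simp add: card_insert_if)
  then obtain e where "e \<le> n" "e \<notin> {k, l}" using ex_le_notin[of "{k, l}" n] by blast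
  then have "flip k x k = flip l x k"
    using cls_eqD[OF eq, of e k] assms by (simp add: flip_def)
  then show "k = l" by (auto simp: flip_def)
qed simp

text \<open>For $n = 2$ the graph is $K_4$, where the common neighbour argument fails, but then flipping two of
  the three coordinates amounts to flipping the third.\<close>

lemma Aut_flip_flip:
  assumes n: "even n" "n \<ge> 2" and g: "g \<in> carrier (Aut (folded_hypercube n))"
    and le: "i \<le> n" "j \<le> n" "p \<le> n" "q \<le> n" and ij: "i \<noteq> j"
    and g0: "g (cls n x) = cls n y"
    and g1: "g (cls n (flip i x)) = cls n (flip p y)" "g (cls n (flip j x)) = cls n (flip q y)"
  shows "g (cls n (flip i (flip j x))) = cls n (flip p (flip q y))"
proof -
  have inj: "g (cls n z) = g (cls n w) \<longleftrightarrow> cls n z = cls n w" for z w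
    using g by (auto simp: Aut_carrier Bij_def bij_betw_def inj_on_eq_iff)
  have adj: "\<exists>k\<le>n. g (cls n w) = cls n (flip k z')"
    if "k \<le> n" "cls n w = cls n (flip k z)" "g (cls n z) = cls n z'" for k z w z'
  proof -
    have "{cls n z, cls n w} \<in> edges (folded_hypercube n)" using that edge_folded_hypercube_iff by blast
    then have e: "{g (cls n z), g (cls n w)} \<in> edges (folded_hypercube n)"
      using g unfolding Aut_carrier graph_iso_def by simp
    have "g (cls n w) \<in> verts (hypercube n)"
      using g by (rule Aut_folded_in_verts) simp
    then obtain w' where "g (cls n w) = cls n w'" by (rule cls_cases)
    with e that show ?thesis by (auto simp: edge_folded_hypercube_iff)
  qed
  have "cls n (flip p y) \<noteq> cls n (flip q y)"
    unfolding g1[symmetric] inj using cls_flip_eq_iff le n ij by blast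
  then have pq: "p \<noteq> q" by blast
  show ?thesis
  proof (cases "n = 2")
    case True
    obtain k where k: "k \<le> n" "k \<noteq> i" "k \<noteq> j"
    proof -
      have "\<exists>k\<le>2. k \<noteq> i \<and> k \<noteq> j" by presburger
      then show ?thesis using that True by blast
    qed
    obtain r where r: "r \<le> n" "g (cls n (flip k x)) = cls n (flip r y)"
      using adj[OF k(1) refl g0] by blast
    have "cls n (flip r y) \<noteq> cls n (flip p y)" "cls n (flip r y) \<noteq> cls n (flip q y)"
      unfolding g1[symmetric] r(2)[symmetric] inj using cls_flip_eq_iff le n k by blast+
    then have rpq: "r \<noteq> p" "r \<noteq> q" by auto
    have *: "cls n (flip c (flip d z)) = cls n (flip e z)"
      if "c \<le> n" "d \<le> n" "e \<le> n" "c \<noteq> d" "c \<noteq> e" "d \<noteq> e" for c d e z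
    proof -
      have "i = c \<or> i = d \<or> i = e" if "i \<le> n" for i
        using that \<open>c \<le> n\<close> \<open>d \<le> n\<close> \<open>e \<le> n\<close> \<open>c \<noteq> d\<close> \<open>c \<noteq> e\<close> \<open>d \<noteq> e\<close> unfolding True by presburger
      then have "flip c (flip d z) i \<noteq> flip e z i" if "i \<le> n" for i
        using that \<open>c \<noteq> d\<close> \<open>c \<noteq> e\<close> \<open>d \<noteq> e\<close> by (fastforce simp: flip_def)
      then show ?thesis unfolding cls_eq_iff by blast
    qed
    show ?thesis using * le k r ij pq rpq by metis
  next
    case False
    \<comment> \<open>Evenness skips \<open>n = 3\<close>, where the folded cube is the complete
      bipartite graph on 4 + 4 vertices and vertices at distance two have four common neighbours.
      From \<open>n = 4\<close> on there are at least five coordinates, and the four flips compared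
      below leave one untouched.\<close>
    then have n4: "n \<ge> 4" using n by presburger
    have fl: "flip i (flip j x) = flip j (flip i x)" by (auto simp: flip_def)
    obtain s where s: "s \<le> n" "g (cls n (flip i (flip j x))) = cls n (flip s (flip p y))"
      using adj[OF le(2) _ g1(1)] fl by metis
    obtain t where t: "t \<le> n" "g (cls n (flip i (flip j x))) = cls n (flip t (flip q y))"
      using adj[OF le(1) refl g1(2)] by metis
    have "card {s, p, t, q} \<le> n" using n4 by (simp add: card_insert_if)
    then obtain e where e: "e \<le> n" "e \<notin> {s, p, t, q}" using ex_le_notin[of "{s, p, t, q}" n] by blast
    have "cls n (flip s (flip p y)) = cls n (flip t (flip q y))" using s t by simp
    from cls_eqD[OF this e(1)] have eq: "flip s (flip p y) i = flip t (flip q y) i" if "i \<le> n" for i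
      using e(2) that by (simp add: flip_def)
    have "s \<noteq> p"
    proof
      assume "s = p"
      then have "g (cls n (flip i (flip j x))) = g (cls n x)"
        using s g0 by simp
      then have "cls n (flip i (flip j x)) = cls n x" by (simp add: inj)
      moreover have "card {i, j} \<le> n" using n by (simp add: card_insert_if)
      then obtain e where "e \<le> n" "e \<notin> {i, j}" using ex_le_notin[of "{i, j}" n] by blast
      ultimately have "flip i (flip j x) i = x i"
        using cls_eqD[of n "flip i (flip j x)" x e i] le by (simp add: flip_def)
      then show False using ij by (simp add: flip_def)
    qed
    \<comment> \<open>By \<open>eq\<close> the same coordinates are flipped along both paths. As
      \<open>p\<close> differs from both \<open>s\<close> and \<open>q\<close>, reading this off at
      \<open>q\<close>, \<open>s\<close> and \<open>p\<close> leaves only the crossed matching of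
      the two pairs.\<close>
    then have "s = q" using eq[OF le(4)] eq[OF s(1)] eq[OF le(3)] pq by (auto simp: flip_def split: if_splits)
    moreover have "flip q (flip p y) = flip p (flip q y)" by (auto simp: flip_def)
    ultimately show ?thesis using s by simp
  qed
qed

text \<open>The image of the zero class supplies \<open>a\<close>, the images of its neighbours
  supply \<open>s\<close>. All other images follow by induction on the support \<open>S\<close>:
  with two elements \<open>i\<close>, \<open>j\<close> removed, the images for \<open>?T\<close>,
  \<open>insert i ?T\<close> and \<open>insert j ?T\<close> determine the one for \<open>S\<close>
  by \<open>Aut_flip_flip\<close>. Supports with at most one element are the base.\<close>

lemma Aut_folded_hypercube_cases:
  assumes n: "even n" "n \<ge> 2" and g: "g \<in> carrier (Aut (folded_hypercube n))"
  obtains a \<tau> where "bij_betw \<tau> {..n} {..n}" "g = aff n a \<tau>"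
proof -
  let ?z = "\<lambda>S i. i \<in> (S :: nat set)"
  have inV: "g u \<in> verts (hypercube n)" if "u \<in> verts (hypercube n)" for u
    using g that by (rule Aut_folded_in_verts)
  have inj: "g (cls n z) = g (cls n w) \<longleftrightarrow> cls n z = cls n w" for z w
    using g by (auto simp: Aut_carrier Bij_def bij_betw_def inj_on_eq_iff)
  obtain a where a: "g (cls n (?z {})) = cls n a" using inV[OF cls_in_verts] by (rule cls_cases)
  have "\<exists>l\<le>n. g (cls n (flip k (?z {}))) = cls n (flip l a)" if "k \<le> n" for k
  proof -
    have "{cls n (?z {}), cls n (flip k (?z {}))} \<in> edges (folded_hypercube n)"
      using that edge_folded_hypercube_iff by blast
    then have "{cls n a, g (cls n (flip k (?z {})))} \<in> edges (folded_hypercube n)"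
      using g a unfolding Aut_carrier graph_iso_def by force
    moreover obtain w where "g (cls n (flip k (?z {}))) = cls n w"
      using inV[OF cls_in_verts] by (rule cls_cases)
    ultimately show ?thesis by (simp add: edge_folded_hypercube_iff)
  qed
  then obtain s where s: "\<And>k. k \<le> n \<Longrightarrow> s k \<le> n \<and> g (cls n (flip k (?z {}))) = cls n (flip (s k) a)"
    by metis
  have "inj_on s {..n}"
  proof (rule inj_onI)
    fix k l assume "k \<in> {..n}" "l \<in> {..n}" "s k = s l"
    then have "cls n (flip k (?z {})) = cls n (flip l (?z {}))" using s inj by (metis atMost_iff)
    then show "k = l" using \<open>k \<in> _\<close> \<open>l \<in> _\<close> n cls_flip_eq_iff by simp
  qed
  moreover have "s ` {..n} \<subseteq> {..n}" using s by auto
  ultimately have bs: "bij_betw s {..n} {..n}"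
    by (simp add: bij_betw_def endo_inj_surj)
  have main: "g (cls n (?z S)) = cls n (\<lambda>l. a l \<noteq> (l \<in> s ` S))" if "S \<subseteq> {..n}" for S
    using finite_subset[OF that finite_atMost] that
  proof (induction S rule: finite_psubset_induct)
    case (psubset S)
    consider "S = {}" | k where "S = {k}" | i j where "i \<in> S" "j \<in> S" "i \<noteq> j" by blast
    then show ?case
    proof cases
      case 1 then show ?thesis using a by simp
    next
      case 2
      have "?z S = flip k (?z {})" "(\<lambda>l. a l \<noteq> (l \<in> s ` S)) = flip (s k) a"
        using 2 by (auto simp: flip_def)
      then show ?thesis using s psubset.prems 2 by simp
    next
      case 3
      let ?T = "S - {i, j}"
      have ijn: "i \<le> n" "j \<le> n" using 3 psubset.prems by auto
      have si: "s k \<in> s ` U \<longleftrightarrow> k \<in> U" if "k \<le> n" "U \<subseteq> {..n}" for k U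
        using bs that by (meson atMost_iff bij_betw_imp_inj_on inj_on_image_mem_iff)
      have Tn: "?T \<subseteq> {..n}" using psubset.prems by auto
      have fi: "flip c (\<lambda>l. a' l \<noteq> (l \<in> U)) = (\<lambda>l. a' l \<noteq> (l \<in> insert c U))" if "c \<notin> U" for c U a'
        using that by (intro ext) (auto simp: flip_def)
      have f: "flip k (?z ?T) = ?z (insert k ?T)" "flip (s k) (\<lambda>l. a l \<noteq> (l \<in> s ` ?T)) = (\<lambda>l. a l \<noteq> (l \<in> s ` insert k ?T))"
        if "k \<in> {i, j}" for k
        using that si[OF _ Tn, of k] ijn fi[of k ?T "\<lambda>_. False"] fi[of "s k" "s ` ?T" a] by auto
      have f2: "flip i (flip j (?z ?T)) = ?z S" using 3 by (auto simp: flip_def)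
      have sij: "s i \<noteq> s j" using si[of i "{j}"] 3 ijn by auto
      have nin: "s i \<notin> s ` ?T" "s j \<notin> s ` ?T" using si[OF _ Tn] ijn by auto
      have "s ` S = insert (s i) (insert (s j) (s ` ?T))" using 3 by auto
      then have f3: "flip (s i) (flip (s j) (\<lambda>l. a l \<noteq> (l \<in> s ` ?T))) = (\<lambda>l. a l \<noteq> (l \<in> s ` S))"
        using sij nin fi[of "s j" "s ` ?T" a] fi[of "s i" "insert (s j) (s ` ?T)" a] by simp
      have "g (cls n (?z ?T)) = cls n (\<lambda>l. a l \<noteq> (l \<in> s ` ?T))"
        using 3 psubset.prems by (intro psubset.IH) auto
      moreover have "g (cls n (flip i (?z ?T))) = cls n (flip (s i) (\<lambda>l. a l \<noteq> (l \<in> s ` ?T)))"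
        unfolding f[OF insertI1] using 3 psubset.prems by (intro psubset.IH) auto
      moreover have "g (cls n (flip j (?z ?T))) = cls n (flip (s j) (\<lambda>l. a l \<noteq> (l \<in> s ` ?T)))"
        unfolding f[OF insertI2[OF singletonI]] using 3 psubset.prems by (intro psubset.IH) auto
      ultimately show ?thesis
        using Aut_flip_flip[OF n g ijn _ _ 3(3)] s ijn f2 f3 by metis
    qed
  qed
  \<comment> \<open>\<open>s\<close> pushes flipped coordinates forward, whereas \<open>aff\<close>
    pulls vectors back; hence the inverse.\<close>
  define \<tau> where "\<tau> = inv_into {..n} s"
  have b: "bij_betw \<tau> {..n} {..n}" unfolding \<tau>_def using bs by (rule bij_betw_inv_into)
  have "g (cls n x) = aff n a \<tau> (cls n x)" for x
  proof -
    let ?S = "{i. i \<le> n \<and> x i}"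
    have "cls n x = cls n (?z ?S)" by (rule cls_cong) simp
    then have "g (cls n x) = cls n (\<lambda>l. a l \<noteq> (l \<in> s ` ?S))" using main[of ?S] by auto
    also have "\<dots> = cls n (\<lambda>l. a l \<noteq> x (\<tau> l))"
    proof (rule cls_cong)
      fix l assume l: "l \<le> n"
      have "\<tau> l \<le> n" using b l by (meson atMost_iff bij_betw_apply)
      moreover have "s (\<tau> l) = l" unfolding \<tau>_def using bs l
        by (simp add: bij_betw_inv_into_right)
      moreover have "\<tau> (s i) = i" if "i \<le> n" for i
        unfolding \<tau>_def using bs that by (simp add: bij_betw_inv_into_left)
      ultimately have "l \<in> s ` ?S \<longleftrightarrow> x (\<tau> l)" by (auto intro: rev_image_eqI)
      then show "(a l \<noteq> (l \<in> s ` ?S)) = (a l \<noteq> x (\<tau> l))" by (simp only:)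
    qed
    finally show ?thesis by (simp only: aff_cls[OF b])
  qed
  then have "g u = aff n a \<tau> u" if "u \<in> verts (hypercube n)" for u
    using that by (elim cls_cases) simp
  moreover have "g \<in> extensional (verts (hypercube n))" "aff n a \<tau> \<in> extensional (verts (hypercube n))"
    using g by (simp_all add: Aut_carrier Bij_def aff_def)
  ultimately have "g = aff n a \<tau>" using extensionalityI by metis
  with b show ?thesis by (rule that)
qed

section \<open>The automorphism group as a semidirect product\<close>

lemma carrier_F2_space: "carrier (F2_space m) = {..2 * m} \<rightarrow>\<^sub>E {0..<2}"
  by (simp add: F2_space_def carrier_integer_mod_group atLeast0AtMost)

lemma F2_space_cases:
  assumes "u \<in> carrier (F2_space m)" "i \<le> 2 * m"
  shows "u i = 0 \<or> u i = 1"
proof -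
  have "u i \<in> {0..<2}"
    using assms PiE_mem[of u "{..2 * m}" "\<lambda>_. {0..<2}" i] unfolding carrier_F2_space by simp
  then show ?thesis by auto
qed

lemma mult_F2_space: "v \<otimes>\<^bsub>F2_space m\<^esub> w = (\<lambda>i\<in>{..2 * m}. (v i + w i) mod 2)"
  by (simp add: F2_space_def atLeast0AtMost)

lemma one_F2_space: "\<one>\<^bsub>F2_space m\<^esub> = (\<lambda>i\<in>{..2 * m}. 0)"
  by (simp add: F2_space_def atLeast0AtMost)

lemma comm_group_F2_space: "comm_group (F2_space m)"
proof (rule group.group_comm_groupI)
  show "Group.group (F2_space m)" by (simp add: F2_space_def)
qed (simp add: mult_F2_space add.commute)

lemma finprod_basis_vec:
  "finprod (F2_space m) (basis_vec m) {0..2 * m} = (\<lambda>i\<in>{..2 * m}. 1)"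
proof -
  interpret comm_group "F2_space m" by (rule comm_group_F2_space)
  have b: "basis_vec m i \<in> carrier (F2_space m)" for i
    by (auto simp: basis_vec_def carrier_F2_space)
  have "finprod (F2_space m) (basis_vec m) S = (\<lambda>i\<in>{..2 * m}. if i \<in> S then 1 else 0)"
    if "S \<subseteq> {..2 * m}" for S
    using finite_subset[OF that finite_atMost] that
  proof (induction S rule: finite_induct)
    case (insert k S)
    then have "finprod (F2_space m) (basis_vec m) (insert k S) =
        basis_vec m k \<otimes>\<^bsub>F2_space m\<^esub> (\<lambda>i\<in>{..2 * m}. if i \<in> S then 1 else 0)"
      using b by (subst finprod_insert) (auto simp: restrict_def)
    also have "\<dots> = (\<lambda>i\<in>{..2 * m}. if i \<in> insert k S then 1 else 0)"
      unfolding mult_F2_space using insert.hyps insert.prems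
      by (intro restrict_ext) (auto simp: basis_vec_def)
    finally show ?case .
  qed (simp add: one_F2_space)
  then have "finprod (F2_space m) (basis_vec m) {..2 * m} = (\<lambda>i\<in>{..2 * m}. if i \<in> {..2 * m} then 1 else 0)"
    by blast
  also have "\<dots> = (\<lambda>i\<in>{..2 * m}. 1)" by (rule restrict_ext) simp
  finally show ?thesis by (simp only: atLeast0AtMost)
qed

text \<open>The cosets making up the quotient are the fibres of \<open>vec_class\<close>.\<close>

definition vec_class :: "nat \<Rightarrow> (nat \<Rightarrow> int) \<Rightarrow> nat \<Rightarrow> nat"
  where "vec_class m v = cls (2 * m) (\<lambda>i. v i = 1)"

definition vec_coset :: "nat \<Rightarrow> (nat \<Rightarrow> int) \<Rightarrow> (nat \<Rightarrow> int) set"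
  where "vec_coset m v = {w \<in> carrier (F2_space m). vec_class m w = vec_class m v}"

text \<open>Addition modulo 2 is exclusive or, and complementing a summand complements the sum. The
  class of a sum thus depends on the classes of the summands only, which makes arbitrary coset
  representatives usable.\<close>

lemma vec_class_mult_cong:
  assumes "vec_class m v = vec_class m v'" "vec_class m w = vec_class m w'"
    and "v \<in> carrier (F2_space m)" "v' \<in> carrier (F2_space m)"
    and "w \<in> carrier (F2_space m)" "w' \<in> carrier (F2_space m)"
  shows "vec_class m (v \<otimes>\<^bsub>F2_space m\<^esub> w) = cls (2 * m) (\<lambda>i. (v' i = 1) \<noteq> (w' i = 1))"
proof -
  have "((v \<otimes>\<^bsub>F2_space m\<^esub> w) i = 1) = ((v i = 1) \<noteq> (w i = 1))" if "i \<le> 2 * m" for i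
    using F2_space_cases[OF assms(3) that] F2_space_cases[OF assms(5) that] that by (auto simp: mult_F2_space)
  then have "vec_class m (v \<otimes>\<^bsub>F2_space m\<^esub> w) = cls (2 * m) (\<lambda>i. (v i = 1) \<noteq> (w i = 1))"
    unfolding vec_class_def by (intro cls_cong)
  also have "\<dots> = cls (2 * m) (\<lambda>i. (v' i = 1) \<noteq> (w' i = 1))"
    using assms(1,2) unfolding vec_class_def cls_eq_iff by blast
  finally show ?thesis .
qed

text \<open>The all-ones vector is its own inverse, so it generates a subgroup of two elements, and
  each coset consists of a vector and its complement.\<close>

lemma carrier_F2_quotient: "carrier (F2_quotient m) = vec_coset m ` carrier (F2_space m)"
proof -
  interpret comm_group "F2_space m" by (rule comm_group_F2_space)
  let ?j = "\<lambda>i\<in>{..2 * m}. 1 :: int" and ?o = "\<lambda>i\<in>{..2 * m}. 0 :: int"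
  have j: "?j \<in> carrier (F2_space m)" by (auto simp: carrier_F2_space)
  have jj: "?j \<otimes>\<^bsub>F2_space m\<^esub> ?j = ?o" by (auto simp: mult_F2_space)
  then have invj: "inv\<^bsub>F2_space m\<^esub> ?j = ?j" using j inv_equality by (simp add: one_F2_space)
  have "x \<in> {?o, ?j}" if "x \<in> generate (F2_space m) {?j}" for x
    using that
  proof (induction x rule: generate.induct)
    case (eng h1 h2)
    then show ?case using jj r_one[OF j] l_one[OF j] r_one[OF one_closed] unfolding one_F2_space by blast
  qed (use invj in \<open>auto simp: one_F2_space\<close>)
  moreover have "{?o, ?j} \<subseteq> generate (F2_space m) {?j}"
    using generate.one[of "F2_space m"] generate.incl[of ?j "{?j}"] by (simp add: one_F2_space)
  ultimately have gen: "generate (F2_space m) {?j} = {?o, ?j}" by blast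
  have "generate (F2_space m) {?j} #>\<^bsub>F2_space m\<^esub> v = vec_coset m v"
    if v: "v \<in> carrier (F2_space m)" for v
  proof -
    have ov: "?o \<otimes>\<^bsub>F2_space m\<^esub> v = v" using l_one[OF v] by (simp add: one_F2_space)
    have jv: "(?j \<otimes>\<^bsub>F2_space m\<^esub> v) i = 1 - v i" if "i \<le> 2 * m" for i
      using F2_space_cases[OF v that] that by (auto simp: mult_F2_space)
    have jvc: "?j \<otimes>\<^bsub>F2_space m\<^esub> v \<in> carrier (F2_space m)" using j v by simp
    have eqI: "x = y" if "x \<in> carrier (F2_space m)" "y \<in> carrier (F2_space m)" "\<And>i. i \<le> 2 * m \<Longrightarrow> x i = y i" for x y
      using that unfolding carrier_F2_space by (intro PiE_ext) auto
    show ?thesis unfolding gen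
    proof (intro equalityI subsetI)
      fix x assume "x \<in> {?o, ?j} #>\<^bsub>F2_space m\<^esub> v"
      then consider "x = v" | "x = ?j \<otimes>\<^bsub>F2_space m\<^esub> v" using ov by (auto simp: r_coset_def)
      then show "x \<in> vec_coset m v"
      proof cases
        case 2
        have "(x i = 1) \<noteq> (v i = 1)" if "i \<le> 2 * m" for i
          using jv[OF that] F2_space_cases[OF v that] 2 by auto
        then have "vec_class m x = vec_class m v" unfolding vec_class_def cls_eq_iff by blast
        then show ?thesis using 2 jvc by (simp add: vec_coset_def)
      qed (simp add: vec_coset_def v)
    next
      fix x assume "x \<in> vec_coset m v"
      then have x: "x \<in> carrier (F2_space m)" and "vec_class m x = vec_class m v"
        by (simp_all add: vec_coset_def)
      then consider "\<forall>i\<le>2 * m. (x i = 1) = (v i = 1)" | "\<forall>i\<le>2 * m. (x i = 1) \<noteq> (v i = 1)"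
        unfolding vec_class_def cls_eq_iff by blast
      then have "x = v \<or> x = ?j \<otimes>\<^bsub>F2_space m\<^esub> v"
      proof cases
        case 1
        have "x = v" using 1 F2_space_cases[OF x] F2_space_cases[OF v] by (intro eqI[OF x v]) force
        then show ?thesis ..
      next
        case 2
        have "x = ?j \<otimes>\<^bsub>F2_space m\<^esub> v"
          using 2 F2_space_cases[OF x] F2_space_cases[OF v] jv by (intro eqI[OF x jvc]) force
        then show ?thesis ..
      qed
      then show "x \<in> {?o, ?j} #>\<^bsub>F2_space m\<^esub> v" using ov by (auto simp: r_coset_def)
    qed
  qed
  then show ?thesis
    unfolding F2_quotient_def carrier_FactGroup finprod_basis_vec by (intro image_cong refl)
qed

lemma comm_group_F2_quotient: "comm_group (F2_quotient m)"
proof -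
  interpret comm_group "F2_space m" by (rule comm_group_F2_space)
  have "(\<lambda>i\<in>{..2 * m}. 1 :: int) \<in> carrier (F2_space m)" by (auto simp: carrier_F2_space)
  then show ?thesis
    unfolding F2_quotient_def finprod_basis_vec
    by (intro abelian_FactGroup generate_is_subgroup) simp
qed

text \<open>Permuting coordinates commutes with complementation, and permuting back gives preimages,
  so a coset is mapped onto a whole coset. This keeps products of the semidirect product within its
  carrier.\<close>

lemma perm_vec_image_vec_coset:
  assumes s: "\<sigma> \<in> Bij {..2 * m}" and w: "w \<in> carrier (F2_space m)"
  shows "perm_vec m \<sigma> ` vec_coset m w = vec_coset m (perm_vec m \<sigma> w)"
proof -
  let ?n = "2 * m"
  let ?s = "inv_into {..2 * m} \<sigma>"
  have b: "bij_betw \<sigma> {..?n} {..?n}" using s by (simp add: Bij_def)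
  have sl: "?s i \<le> ?n" "\<sigma> i \<le> ?n" if "i \<le> ?n" for i
    using bij_betw_apply[OF bij_betw_inv_into[OF b], of i] bij_betw_apply[OF b, of i] that by auto
  have inv: "?s (\<sigma> i) = i" "\<sigma> (?s i) = i" if "i \<le> ?n" for i
    using b that by (simp_all add: bij_betw_inv_into_left bij_betw_inv_into_right)
  have pw: "perm_vec m \<sigma> u i = u (?s i)" if "i \<le> ?n" for u i
    using that by (simp add: perm_vec_def atLeast0AtMost)
  have re: "(\<forall>i\<le>?n. Q (?s i)) \<longleftrightarrow> (\<forall>i\<le>?n. Q i)" for Q using sl inv by metis
  have cl: "vec_class m (perm_vec m \<sigma> x) = vec_class m (perm_vec m \<sigma> y) \<longleftrightarrow> vec_class m x = vec_class m y" for x y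
    unfolding vec_class_def cls_eq_iff
      re[of "\<lambda>i. (x i = 1) = (y i = 1)", symmetric] re[of "\<lambda>i. (x i = 1) \<noteq> (y i = 1)", symmetric]
    by (simp add: pw cong: conj_cong)
  have pc: "perm_vec m \<sigma> x \<in> carrier (F2_space m)" if "x \<in> carrier (F2_space m)" for x
    using that sl by (auto simp: perm_vec_def carrier_F2_space atLeast0AtMost PiE_iff)
  show ?thesis
  proof (intro equalityI subsetI)
    fix x assume "x \<in> vec_coset m (perm_vec m \<sigma> w)"
    then have x: "x \<in> carrier (F2_space m)" "vec_class m x = vec_class m (perm_vec m \<sigma> w)"
      by (simp_all add: vec_coset_def)
    define y where "y = (\<lambda>i\<in>{..?n}. x (\<sigma> i))"
    have "y \<in> carrier (F2_space m)"
      using x(1) sl by (auto simp: y_def carrier_F2_space PiE_iff)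
    moreover have xy: "x = perm_vec m \<sigma> y"
    proof (rule extensionalityI[of _ "{..?n}"])
      show "x \<in> extensional {..?n}" using x(1) by (simp add: carrier_F2_space PiE_def)
      fix i assume "i \<in> {..?n}"
      then show "x i = perm_vec m \<sigma> y i" using sl inv by (simp add: pw y_def)
    qed (simp add: perm_vec_def atLeast0AtMost)
    ultimately show "x \<in> perm_vec m \<sigma> ` vec_coset m w"
      using x(2) cl by (auto simp: vec_coset_def)
  qed (auto simp: vec_coset_def pc cl)
qed

section \<open>Comparison of affine maps with the semidirect product\<close>

lemma aff_cong:
  assumes "bij_betw \<tau> {..n} {..n}" "bij_betw \<tau>' {..n} {..n}"
    and "cls n a = cls n b" "\<And>i. i \<le> n \<Longrightarrow> \<tau> i = \<tau>' i"
  shows "aff n a \<tau> = aff n b \<tau>'"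
proof -
  have "aff n a \<tau> u = aff n b \<tau>' u" if "u \<in> verts (hypercube n)" for u
  proof -
    from that obtain x where x: "u = cls n x" by (rule cls_cases)
    have "cls n (\<lambda>i. a i \<noteq> x (\<tau> i)) = cls n (\<lambda>i. b i \<noteq> x (\<tau>' i))"
      using assms(3,4) unfolding cls_eq_iff by auto
    then show ?thesis unfolding x aff_cls[OF assms(1)] aff_cls[OF assms(2)] .
  qed
  then show ?thesis
    by (intro extensionalityI[of _ "verts (hypercube n)"]) (auto simp: aff_def)
qed

text \<open>The image of the zero class recovers the class of \<open>a\<close>. Evaluation at the
  indicator of the coordinate \<open>\<tau> i\<close> then compares the flips of \<open>a\<close> at
  \<open>i\<close> and at the preimage \<open>j\<close> of \<open>\<tau> i\<close> under
  \<open>\<tau>'\<close>, and different flips give different classes.\<close>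

lemma aff_eqD:
  assumes n: "n \<ge> 2" and \<tau>: "bij_betw \<tau> {..n} {..n}" "bij_betw \<tau>' {..n} {..n}"
    and eq: "aff n a \<tau> = aff n b \<tau>'"
  shows "cls n a = cls n b" "i \<le> n \<Longrightarrow> \<tau> i = \<tau>' i"
proof -
  have e: "cls n (\<lambda>i. a i \<noteq> x (\<tau> i)) = cls n (\<lambda>i. b i \<noteq> x (\<tau>' i))" for x
    using fun_cong[OF eq, of "cls n x"] by (simp only: aff_cls[OF \<tau>(1)] aff_cls[OF \<tau>(2)])
  show ab: "cls n a = cls n b" using e[of "\<lambda>_. False"] by simp
  assume i: "i \<le> n"
  have "\<tau> i \<in> {..n}" using bij_betw_apply[OF \<tau>(1)] i by simp
  then obtain j where j: "j \<le> n" "\<tau>' j = \<tau> i"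
    using \<tau>(2) unfolding bij_betw_def by (metis atMost_iff imageE)
  have t1: "(\<tau> l = \<tau> i) = (l = i)" and t2: "(\<tau>' l = \<tau> i) = (l = j)" if "l \<le> n" for l
    using \<tau> i j that unfolding bij_betw_def inj_on_def by (auto simp flip: j(2))
  have "cls n (flip i a) = cls n (\<lambda>l. a l \<noteq> (\<tau> l = \<tau> i))"
    by (rule cls_cong) (simp only: flip_def t1)
  also have "\<dots> = cls n (\<lambda>l. b l \<noteq> (\<tau>' l = \<tau> i))" by (rule e)
  also have "\<dots> = cls n (flip j b)" by (rule cls_cong) (simp only: flip_def t2)
  also have "\<dots> = cls n (flip j a)" using ab unfolding cls_eq_iff flip_def by blast
  finally have "i = j" using cls_flip_eq_iff n i j by blast
  then show "\<tau> i = \<tau>' i" using j by simp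
qed

text \<open>The isomorphism is built in the opposite direction and inverted at the end: the coset of
  \<open>v\<close> together with \<open>\<sigma>\<close> goes to the permutation by
  \<open>\<sigma>\<close> followed by the translation by \<open>v\<close>. The inverse of
  \<open>\<sigma>\<close> appears because \<open>aff\<close> precomposes, and moving each basis
  vector along \<open>\<sigma>\<close> is precomposition with the inverse.\<close>

theorem Aut_folded_hypercube_iso:
  assumes m: "m \<ge> 1"
  shows "Aut (folded_hypercube (2 * m)) \<cong> C2_semidirect_Sym m"
proof -
  let ?n = "2 * m" and ?F = "F2_space m" and ?S = "C2_semidirect_Sym m"
  let ?A = "Aut (folded_hypercube (2 * m))" and ?V = "verts (hypercube (2 * m))"
  have n: "even ?n" "?n \<ge> 2" using m by auto
  let ?rep = "\<lambda>C. SOME v :: nat \<Rightarrow> int. v \<in> C"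
  define h where "h = (\<lambda>(C, \<sigma>). aff ?n (\<lambda>i. ?rep C i = 1) (inv_into {..?n} \<sigma>))"
  have carS: "carrier ?S = vec_coset m ` carrier ?F \<times> Bij {..?n}"
    by (simp add: C2_semidirect_Sym_def semidirect_product_def carrier_F2_quotient BijGroup_def atLeast0AtMost)
  have multS: "(C, \<sigma>) \<otimes>\<^bsub>?S\<^esub> (D, \<rho>) = (C <#>\<^bsub>?F\<^esub> (perm_vec m \<sigma> ` D), compose {..?n} \<sigma> \<rho>)"
    if "\<sigma> \<in> Bij {..?n}" "\<rho> \<in> Bij {..?n}" for C \<sigma> D \<rho>
    using that by (simp add: C2_semidirect_Sym_def semidirect_product_def BijGroup_def atLeast0AtMost F2_quotient_def)
  have multA: "g \<otimes>\<^bsub>?A\<^esub> k = compose ?V g k" if "g \<in> carrier ?A" "k \<in> carrier ?A" for g k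
    using that by (simp add: Aut_def BijGroup_def)
  have bij_inv: "bij_betw (inv_into {..?n} \<sigma>) {..?n} {..?n}" if "\<sigma> \<in> Bij {..?n}" for \<sigma>
    using that by (simp add: Bij_def bij_betw_inv_into)
  have rep: "?rep C \<in> C" if "x \<in> C" for C and x :: "nat \<Rightarrow> int" using that by (metis someI)
  have self: "v \<in> vec_coset m v" if "v \<in> carrier ?F" for v using that by (simp add: vec_coset_def)
  have h: "h (vec_coset m v, \<sigma>) = aff ?n (\<lambda>i. v i = 1) (inv_into {..?n} \<sigma>)"
    if "v \<in> carrier ?F" "\<sigma> \<in> Bij {..?n}" for v \<sigma>
    using rep[OF self[OF that(1)]] unfolding h_def prod.case
    by (intro aff_cong bij_inv that refl) (simp add: vec_coset_def vec_class_def)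
  have perm: "perm_vec m \<sigma> w \<in> carrier ?F" if "w \<in> carrier ?F" "\<sigma> \<in> Bij {..?n}" for w \<sigma>
    using that bij_betw_apply[OF bij_inv[OF that(2)]]
    by (auto simp: perm_vec_def carrier_F2_space atLeast0AtMost PiE_iff)
  have "h \<in> hom ?S ?A"
  proof (rule homI)
    fix z assume "z \<in> carrier ?S"
    then show "h z \<in> carrier ?A"
      unfolding carS by (auto simp: h_def intro!: aff_in_Aut bij_inv)
  next
    fix z z' assume "z \<in> carrier ?S" "z' \<in> carrier ?S"
    then obtain v \<sigma> w \<rho> where z: "z = (vec_coset m v, \<sigma>)" "z' = (vec_coset m w, \<rho>)"
      and v: "v \<in> carrier ?F" and w: "w \<in> carrier ?F" and s: "\<sigma> \<in> Bij {..?n}" and r: "\<rho> \<in> Bij {..?n}"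
      unfolding carS by auto
    let ?X = "vec_coset m v <#>\<^bsub>?F\<^esub> (perm_vec m \<sigma> ` vec_coset m w)"
    \<comment> \<open>Choice may return any element of the product coset, not just the sum of
      \<open>v\<close> and the permuted \<open>w\<close>. It is still a sum of representatives of
      the two cosets, and that fixes its class.\<close>
    define y where "y = ?rep ?X"
    have "v \<otimes>\<^bsub>?F\<^esub> perm_vec m \<sigma> w \<in> ?X" using self v w by (auto simp: set_mult_def)
    then have "y \<in> ?X" unfolding y_def by (rule rep)
    then obtain v' w' where y: "y = v' \<otimes>\<^bsub>?F\<^esub> perm_vec m \<sigma> w'" and v': "v' \<in> carrier ?F" "vec_class m v' = vec_class m v"
      and w': "w' \<in> carrier ?F" "vec_class m w' = vec_class m w"
      by (auto simp: set_mult_def vec_coset_def)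
    let ?s = "inv_into {..?n} \<sigma>" and ?r = "inv_into {..?n} \<rho>"
    have sl: "?s i \<le> ?n" if "i \<le> ?n" for i using bij_betw_apply[OF bij_inv[OF s]] that by auto
    have pw: "perm_vec m \<sigma> u i = u (?s i)" if "i \<le> ?n" for u i
      using that by (simp add: perm_vec_def atLeast0AtMost)
    have "vec_class m (perm_vec m \<sigma> w') = vec_class m (perm_vec m \<sigma> w)"
      using w'(2) sl pw unfolding vec_class_def cls_eq_iff by auto
    then have "vec_class m y = cls ?n (\<lambda>i. (v i = 1) \<noteq> (perm_vec m \<sigma> w i = 1))"
      unfolding y using vec_class_mult_cong[OF v'(2) _ v'(1) v] perm w'(1) w s by blast
    also have "\<dots> = cls ?n (\<lambda>i. (v i = 1) \<noteq> (w (?s i) = 1))" by (rule cls_cong) (simp only: pw)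
    finally have yc: "cls ?n (\<lambda>i. y i = 1) = cls ?n (\<lambda>i. (v i = 1) \<noteq> (w (?s i) = 1))"
      by (simp only: vec_class_def)
    have comp: "compose {..?n} \<sigma> \<rho> \<in> Bij {..?n}" using s r by (rule compose_Bij)
    have rs: "bij_betw (?r \<circ> ?s) {..?n} {..?n}" using bij_inv[OF s] bij_inv[OF r] by (rule bij_betw_trans)
    have inv_comp: "inv_into {..?n} (compose {..?n} \<sigma> \<rho>) i = (?r \<circ> ?s) i" if "i \<le> ?n" for i
    proof (rule inv_into_f_eq)
      show "inj_on (compose {..?n} \<sigma> \<rho>) {..?n}" using comp by (simp add: Bij_def bij_betw_def)
      show "(?r \<circ> ?s) i \<in> {..?n}" using bij_betw_apply[OF rs] that by blast
      moreover have "\<rho> (?r (?s i)) = ?s i" "\<sigma> (?s i) = i"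
        using s r sl[OF that] that by (auto simp: Bij_def intro: bij_betw_inv_into_right)
      ultimately show "compose {..?n} \<sigma> \<rho> ((?r \<circ> ?s) i) = i"
        by (simp add: compose_def)
    qed
    have "h (z \<otimes>\<^bsub>?S\<^esub> z') = aff ?n (\<lambda>i. y i = 1) (inv_into {..?n} (compose {..?n} \<sigma> \<rho>))"
      unfolding z multS[OF s r] by (simp add: h_def y_def)
    also have "\<dots> = aff ?n (\<lambda>i. (v i = 1) \<noteq> (w (?s i) = 1)) (?r \<circ> ?s)"
      by (intro aff_cong bij_inv comp rs yc inv_comp)
    also have "\<dots> = compose ?V (h z) (h z')"
    proof (rule extensionalityI[of _ ?V])
      fix u assume u: "u \<in> ?V"
      then obtain x where x: "u = cls ?n x" by (rule cls_cases)
      show "aff ?n (\<lambda>i. (v i = 1) \<noteq> (w (?s i) = 1)) (?r \<circ> ?s) u = compose ?V (h z) (h z') u"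
        unfolding compose_eq[OF u] unfolding x z h[OF v s] h[OF w r] aff_cls[OF rs] aff_cls[OF bij_inv[OF s]] aff_cls[OF bij_inv[OF r]]
        by (rule cls_cong) auto
    qed (simp_all add: aff_def compose_def)
    also have "\<dots> = h z \<otimes>\<^bsub>?A\<^esub> h z'"
      unfolding z h[OF v s] h[OF w r] by (intro multA[symmetric] aff_in_Aut bij_inv s r)
    finally show "h (z \<otimes>\<^bsub>?S\<^esub> z') = h z \<otimes>\<^bsub>?A\<^esub> h z'" .
  qed
  moreover have "inj_on h (carrier ?S)"
  proof (rule inj_onI)
    fix z z' assume "z \<in> carrier ?S" "z' \<in> carrier ?S" and eq: "h z = h z'"
    then obtain v \<sigma> w \<rho> where z: "z = (vec_coset m v, \<sigma>)" "z' = (vec_coset m w, \<rho>)"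
      and v: "v \<in> carrier ?F" and w: "w \<in> carrier ?F" and s: "\<sigma> \<in> Bij {..?n}" and r: "\<rho> \<in> Bij {..?n}"
      unfolding carS by auto
    have e: "aff ?n (\<lambda>i. v i = 1) (inv_into {..?n} \<sigma>) = aff ?n (\<lambda>i. w i = 1) (inv_into {..?n} \<rho>)"
      using eq unfolding z h[OF v s] h[OF w r] .
    note eqD = aff_eqD[OF n(2) bij_inv[OF s] bij_inv[OF r] e]
    have "vec_coset m v = vec_coset m w" using eqD(1) by (simp add: vec_coset_def vec_class_def)
    moreover have "\<sigma> = \<rho>"
    proof (rule extensionalityI[of _ "{..?n}"])
      fix i assume i: "i \<in> {..?n}"
      have "\<sigma> i \<in> {..?n}" using s i bij_betw_apply[of \<sigma> "{..?n}" "{..?n}" i] unfolding Bij_def by simp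
      moreover have "inv_into {..?n} \<sigma> (\<sigma> i) = i"
        using s i unfolding Bij_def by (auto intro: bij_betw_inv_into_left)
      ultimately have "inv_into {..?n} \<rho> (\<sigma> i) = i"
        using eqD(2)[of "\<sigma> i"] by simp
      then show "\<sigma> i = \<rho> i"
        using r \<open>\<sigma> i \<in> {..?n}\<close> by (metis Bij_def Int_iff bij_betw_inv_into_right mem_Collect_eq)
    qed (use s r in \<open>simp_all add: Bij_def\<close>)
    ultimately show "z = z'" by (simp add: z)
  qed
  moreover have "carrier ?A \<subseteq> h ` carrier ?S"
  proof
    fix g assume "g \<in> carrier ?A"
    then obtain a \<tau> where \<tau>: "bij_betw \<tau> {..?n} {..?n}" and g: "g = aff ?n a \<tau>"
      using Aut_folded_hypercube_cases[OF n] by blast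
    define v where "v = (\<lambda>i\<in>{..?n}. of_bool (a i) :: int)"
    define \<sigma> where "\<sigma> = (\<lambda>i\<in>{..?n}. inv_into {..?n} \<tau> i)"
    have v: "v \<in> carrier ?F" by (auto simp: v_def carrier_F2_space)
    have s: "\<sigma> \<in> Bij {..?n}" using \<tau> by (simp add: \<sigma>_def Bij_def bij_betw_inv_into)
    have "h (vec_coset m v, \<sigma>) = aff ?n a \<tau>"
      unfolding h[OF v s]
    proof (intro aff_cong bij_inv s \<tau> cls_cong)
      fix i assume i: "i \<le> ?n"
      show "(v i = 1) = a i" using i by (simp add: v_def)
      have ti: "\<tau> i \<in> {..?n}" using bij_betw_apply[OF \<tau>] i by simp
      show "inv_into {..?n} \<sigma> i = \<tau> i"
      proof (rule inv_into_f_eq[OF _ ti])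
        show "inj_on \<sigma> {..?n}" using s by (simp add: Bij_def bij_betw_def)
        show "\<sigma> (\<tau> i) = i"
          using ti bij_betw_inv_into_left[OF \<tau>, of i] i by (simp add: \<sigma>_def)
      qed
    qed
    moreover have "(vec_coset m v, \<sigma>) \<in> carrier ?S" using v s by (simp add: carS)
    ultimately show "g \<in> h ` carrier ?S" unfolding g by (metis imageI)
  qed
  \<comment> \<open>Closure allows the inverse of \<open>h\<close> to be evaluated on a product: the
    product of the two preimages must lie in the domain on which \<open>h\<close> is
    inverted.\<close>
  moreover have "z \<otimes>\<^bsub>?S\<^esub> z' \<in> carrier ?S" if zz: "z \<in> carrier ?S" "z' \<in> carrier ?S" for z z'
  proof -
    obtain v \<sigma> w \<rho> where z: "z = (vec_coset m v, \<sigma>)" "z' = (vec_coset m w, \<rho>)"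
      and v: "v \<in> carrier ?F" and w: "w \<in> carrier ?F" and s: "\<sigma> \<in> Bij {..?n}" and r: "\<rho> \<in> Bij {..?n}"
      using zz unfolding carS by auto
    interpret Q: comm_group "F2_quotient m" by (rule comm_group_F2_quotient)
    have "vec_coset m v \<otimes>\<^bsub>F2_quotient m\<^esub> (perm_vec m \<sigma> ` vec_coset m w) \<in> carrier (F2_quotient m)"
      unfolding perm_vec_image_vec_coset[OF s w]
      using v w perm s by (intro Q.m_closed) (auto simp: carrier_F2_quotient)
    then show ?thesis
      using compose_Bij[OF s r] unfolding z multS[OF s r] carS carrier_F2_quotient
      by (simp add: F2_quotient_def)
  qed
  ultimately have hom: "h \<in> hom ?S ?A" and bij: "bij_betw h (carrier ?S) (carrier ?A)"
    and closed: "\<And>z z'. z \<in> carrier ?S \<Longrightarrow> z' \<in> carrier ?S \<Longrightarrow> z \<otimes>\<^bsub>?S\<^esub> z' \<in> carrier ?S"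
    unfolding bij_betw_def hom_def by blast+
  let ?k = "inv_into (carrier ?S) h"
  have bk: "bij_betw ?k (carrier ?A) (carrier ?S)" using bij by (rule bij_betw_inv_into)
  have "?k \<in> hom ?A ?S"
  proof (rule homI)
    fix g g' assume g: "g \<in> carrier ?A" and g': "g' \<in> carrier ?A"
    have kg: "?k g \<in> carrier ?S" "?k g' \<in> carrier ?S" using bij_betw_apply[OF bk] g g' by blast+
    show "?k (g \<otimes>\<^bsub>?A\<^esub> g') = ?k g \<otimes>\<^bsub>?S\<^esub> ?k g'"
    proof (rule inv_into_f_eq)
      show "inj_on h (carrier ?S)" using bij by (simp add: bij_betw_def)
      show "?k g \<otimes>\<^bsub>?S\<^esub> ?k g' \<in> carrier ?S" using closed kg by blast
      show "h (?k g \<otimes>\<^bsub>?S\<^esub> ?k g') = g \<otimes>\<^bsub>?A\<^esub> g'"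
        unfolding hom_mult[OF hom kg] using bij g g' by (simp add: bij_betw_inv_into_right)
    qed
  qed (use bij_betw_apply[OF bk] in blast)
  with bk have "?k \<in> iso ?A ?S" by (simp add: iso_def)
  then show ?thesis unfolding is_iso_def by blast
qed

section \<open>Functions with constant 2-face sums\<close>

definition sg :: "bool \<Rightarrow> real" where "sg b = (if b then - 1 else 1)"

lemma sg_simps [simp]: "sg True = -1" "sg False = 1" "\<bar>sg b\<bar> = 1" "sg b * sg b = 1"
  by (auto simp: sg_def)

lemma sg_not: "sg (\<not> a) = - sg a" by (simp add: sg_def)

lemma sg_neq: "sg (a \<noteq> b) = sg a * sg b" by (simp add: sg_def)

lemma sg_eq_iff: "sg a = sg b \<longleftrightarrow> a = b" by (simp add: sg_def)

definition par :: "nat \<Rightarrow> (nat \<Rightarrow> bool) \<Rightarrow> real" where "par n x = (\<Prod>i\<le>n. sg (x i))"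

lemma par_cases: "par n x = 1 \<or> par n x = -1"
proof -
  have "\<bar>par n x\<bar> = 1" by (simp add: par_def abs_prod)
  then show ?thesis by (simp add: abs_if split: if_splits)
qed

lemma par_cong: "(\<And>i. i \<le> n \<Longrightarrow> x i = y i) \<Longrightarrow> par n x = par n y"
  by (simp add: par_def)

text \<open>The product has \<open>n + 1\<close> factors, an odd number. Hence exactly one of two
  complementary vectors has product 1, and it can serve as the normal form of its class.\<close>

lemma par_not: "even n \<Longrightarrow> par n (\<lambda>i. \<not> x i) = - par n x"
  by (simp add: par_def sg_not prod_uminus)

lemma par_neq: "par n (\<lambda>i. a i \<noteq> x i) = par n a * par n x"
  unfolding par_def sg_neq by (rule prod.distrib)

lemma sg_flip: "sg (flip k x i) = (if i = k then - sg (x i) else sg (x i))"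
  by (simp add: flip_def sg_def)

lemma par_flip:
  assumes "k \<le> n"
  shows "par n (flip k x) = - par n x"
proof -
  have "par n (flip k x) = sg (flip k x k) * (\<Prod>i\<in>{..n} - {k}. sg (flip k x i))"
    unfolding par_def using assms by (intro prod.remove) auto
  also have "(\<Prod>i\<in>{..n} - {k}. sg (flip k x i)) = (\<Prod>i\<in>{..n} - {k}. sg (x i))"
    by (intro prod.cong) (auto simp: sg_flip)
  also have "sg (flip k x k) * \<dots> = - (sg (x k) * (\<Prod>i\<in>{..n} - {k}. sg (x i)))"
    by (simp add: sg_flip)
  also have "sg (x k) * (\<Prod>i\<in>{..n} - {k}. sg (x i)) = par n x"
    unfolding par_def using assms by (intro prod.remove[symmetric]) auto
  finally show ?thesis .
qed

text \<open>Coordinate \<open>k\<close> is given up in order to repair the product. In the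
  applications it is a coordinate of weight 0, so the weighted sum does not notice the
  repair.\<close>

lemma ex_par_one:
  assumes "k \<le> n"
  obtains y where "\<And>i. i \<noteq> k \<Longrightarrow> y i = x i" "par n y = 1"
proof (cases "par n x = 1")
  case True then show ?thesis using that by blast
next
  case False
  then have "par n (flip k x) = 1" using par_cases[of n x] par_flip[OF assms, of x] by auto
  then show ?thesis using that[of "flip k x"] by (simp add: flip_def)
qed

definition amp :: "nat \<Rightarrow> (nat \<Rightarrow> real) \<Rightarrow> (nat \<Rightarrow> bool) \<Rightarrow> real"
  where "amp n b x = par n x * (\<Sum>i\<le>n. b i * sg (x i))"

lemma amp_cong: "(\<And>i. i \<le> n \<Longrightarrow> x i = y i) \<Longrightarrow> amp n b x = amp n b y"
  by (simp add: amp_def par_def)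

text \<open>Both the product and the sum change sign, the product because \<open>n + 1\<close> is
  odd. This is why \<open>amp\<close> lives on classes.\<close>

lemma amp_not: "even n \<Longrightarrow> amp n b (\<lambda>i. \<not> x i) = amp n b x"
  by (simp add: amp_def par_not sg_not sum_negf)

lemma amp_cls:
  assumes "even n" "cls n x = cls n y"
  shows "amp n b x = amp n b y"
  using assms(2) unfolding cls_eq_iff
proof
  assume "\<forall>i\<le>n. x i = y i" then show ?thesis by (intro amp_cong) auto
next
  assume "\<forall>i\<le>n. x i \<noteq> y i"
  then have "amp n b x = amp n b (\<lambda>i. \<not> y i)" by (intro amp_cong) auto
  then show ?thesis by (simp add: amp_not assms(1))
qed

lemma amp_flip:
  assumes "k \<le> n"
  shows "amp n b (flip k x) = - amp n b x + 2 * par n x * b k * sg (x k)"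
proof -
  have k: "finite {..n}" "k \<in> {..n}" using assms by auto
  have "(\<Sum>i\<le>n. b i * sg (flip k x i)) = b k * sg (flip k x k) + (\<Sum>i\<in>{..n} - {k}. b i * sg (flip k x i))"
    by (rule sum.remove[OF k])
  also have "(\<Sum>i\<in>{..n} - {k}. b i * sg (flip k x i)) = (\<Sum>i\<in>{..n} - {k}. b i * sg (x i))"
    by (intro sum.cong) (auto simp: sg_flip)
  also have "\<dots> = (\<Sum>i\<le>n. b i * sg (x i)) - b k * sg (x k)"
    by (simp add: sum.remove[OF k])
  finally have eq: "(\<Sum>i\<le>n. b i * sg (flip k x i)) = (\<Sum>i\<le>n. b i * sg (x i)) - 2 * b k * sg (x k)"
    by (simp add: sg_flip)
  show ?thesis unfolding amp_def par_flip[OF assms] eq by (simp add: algebra_simps)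
qed

lemma amp_aff:
  assumes "bij_betw \<tau> {..n} {..n}"
  shows "amp n b (\<lambda>i. a i \<noteq> x (\<tau> i)) = par n a * par n x * (\<Sum>i\<le>n. b i * sg (a i) * sg (x (\<tau> i)))"
proof -
  have "par n (\<lambda>i. x (\<tau> i)) = par n x"
    unfolding par_def by (rule prod.reindex_bij_betw[OF assms, of "\<lambda>i. sg (x i)"])
  then show ?thesis by (simp only: amp_def par_neq sg_neq mult.assoc)
qed

definition face_sum :: "nat \<Rightarrow> ((nat \<Rightarrow> nat) \<Rightarrow> real) \<Rightarrow> nat \<Rightarrow> nat \<Rightarrow> (nat \<Rightarrow> bool) \<Rightarrow> real"
  where "face_sum n f i j x = f (cls n x) + f (cls n (flip i x)) + f (cls n (flip j x)) + f (cls n (flip i (flip j x)))"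

text \<open>By \<open>amp_flip\<close> the two ends of an edge in direction \<open>i\<close>
  contribute \<open>2 * par n x * b i * sg (x i)\<close> beyond their share of \<open>K\<close>. The
  parallel edge, shifted in direction \<open>j\<close>, has the opposite product and the same sign
  at \<open>i\<close>, so the two contributions cancel.\<close>

lemma face_sum_amp:
  assumes f: "\<And>x. f (cls n x) = K + amp n b x" and ij: "i \<le> n" "j \<le> n" "i \<noteq> j"
  shows "face_sum n f i j x = 4 * K"
proof -
  have "sg (flip j x i) = sg (x i)" using ij by (simp add: sg_flip)
  then show ?thesis
    unfolding face_sum_def f by (simp add: amp_flip par_flip ij algebra_simps)
qed

lemma amp_if_face_sums:
  assumes n: "even n" and faces: "\<And>x i j. i < n \<Longrightarrow> j < n \<Longrightarrow> i \<noteq> j \<Longrightarrow> face_sum n f i j x = 4 * K"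
  obtains b where "\<And>x. f (cls n x) = K + amp n b x"
proof -
  define B where "B S = f (cls n (\<lambda>i. i \<in> S)) - K" for S
  define D where "D S = (-1) ^ card S * B S" for S
  define \<delta> where "\<delta> i = D {i} - D {}" for i
  \<comment> \<open>The first difference of \<open>D\<close> in direction \<open>i\<close> is the
    same at every \<open>S\<close>: adding \<open>j\<close> to \<open>S\<close> alters it by a mixed
    second difference, which the face sum in directions \<open>i\<close>, \<open>j\<close> makes
    vanish.\<close>
  have step: "D (insert i S) - D S = \<delta> i" if "S \<subseteq> {..<n}" "i < n" "i \<notin> S" for S i
    using finite_subset[OF that(1) finite_lessThan] that(1,3)
  proof (induction S rule: finite_induct)
    case empty
    then show ?case by (simp add: \<delta>_def)
  next
    case (insert j T)
    have fl: "flip k (\<lambda>i. i \<in> S) = (\<lambda>i. i \<in> insert k S)" if "k \<notin> S" for k and S :: "nat set"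
      using that by (auto simp: flip_def)
    have "face_sum n f i j (\<lambda>i. i \<in> T) = 4 * K" using insert \<open>i < n\<close> by (intro faces) auto
    then have "B T + B (insert i T) + B (insert j T) + B (insert i (insert j T)) = 0"
      using insert.prems insert.hyps fl[of i T] fl[of j T] fl[of i "insert j T"]
      by (simp add: face_sum_def B_def)
    then have "(-1) ^ card T * (B T + B (insert i T) + B (insert j T) + B (insert i (insert j T))) = 0" by simp
    then have "D T - D (insert i T) - D (insert j T) + D (insert i (insert j T)) = 0"
      using insert.prems insert.hyps by (simp add: D_def algebra_simps)
    moreover have "D (insert i T) - D T = \<delta> i" using insert.prems by (intro insert.IH) auto
    ultimately show ?case by simp
  qed
  have D: "D S = D {} + sum \<delta> S" if "S \<subseteq> {..<n}" for S
    using finite_subset[OF that finite_lessThan] that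
  proof (induction S rule: finite_induct)
    case (insert i S)
    then show ?case using step[of S i] by simp
  qed simp
  \<comment> \<open>Membership of \<open>i\<close> in \<open>S\<close> counts as (1 - s) / 2 for the
    sign s at \<open>i\<close>, so an increment \<open>\<delta> i\<close> becomes the slope
    \<open>- \<delta> i / 2\<close> and leaves its other half to the constant. The constant is the
    weight of coordinate \<open>n\<close>, whose sign is 1 when
    \<open>S \<subseteq> {..<n}\<close>.\<close>
  define b where "b i = (if i < n then - \<delta> i / 2 else D {} + (\<Sum>i<n. \<delta> i) / 2)" for i
  have BS: "B S = amp n b (\<lambda>i. i \<in> S)" if S: "S \<subseteq> {..<n}" for S
  proof -
    have p: "par n (\<lambda>i. i \<in> S) = (-1) ^ card S"
    proof -
      have "par n (\<lambda>i. i \<in> S) = (\<Prod>i\<in>S. -1)"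
        unfolding par_def using S by (intro prod.mono_neutral_cong_right) (auto simp: sg_def)
      then show ?thesis by simp
    qed
    have "(\<Sum>i\<le>n. b i * sg (i \<in> S)) = (\<Sum>i<n. b i * sg (i \<in> S)) + b n"
    proof -
      have "n \<notin> S" using S by auto
      then show ?thesis by (simp add: lessThan_Suc_atMost[symmetric])
    qed
    also have "\<dots> = (\<Sum>i<n. b i * sg (i \<in> S) + \<delta> i / 2) + D {}"
      by (simp add: b_def[of n] sum.distrib sum_divide_distrib)
    also have "(\<Sum>i<n. b i * sg (i \<in> S) + \<delta> i / 2) = sum \<delta> S"
      using S by (intro sum.mono_neutral_cong_right) (auto simp: b_def sg_def)
    finally have "(\<Sum>i\<le>n. b i * sg (i \<in> S)) = D S" using D[OF S] by simp
    then have "amp n b (\<lambda>i. i \<in> S) = ((-1) ^ card S * (-1) ^ card S) * B S"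
      by (simp only: amp_def p D_def mult.assoc)
    also have "(-1) ^ card S * (-1) ^ card S = (1 :: real)" by (simp flip: power_mult_distrib)
    finally show ?thesis by simp
  qed
  \<comment> \<open>The set of coordinates where \<open>x\<close> differs from its last one
    represents the same class with a last coordinate \<open>False\<close>; \<open>amp_cls\<close>,
    and so the evenness of \<open>n\<close>, carries the formula back to \<open>x\<close>.\<close>
  have "f (cls n x) = K + amp n b x" for x
  proof -
    let ?S = "{i. i < n \<and> x i \<noteq> x n}"
    have c: "cls n x = cls n (\<lambda>i. i \<in> ?S)" unfolding cls_eq_if_lt by auto
    have "?S \<subseteq> {..<n}" by auto
    then have "f (cls n x) = K + amp n b (\<lambda>i. i \<in> ?S)" unfolding c using BS[of ?S] by (simp add: B_def)
    also have "amp n b (\<lambda>i. i \<in> ?S) = amp n b x" by (rule amp_cls[OF n c[symmetric]])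
    finally show ?thesis .
  qed
  then show thesis by (rule that)
qed

lemma bij_betw_flip:
  assumes "k \<le> n"
  obtains g where "bij_betw g (verts (hypercube n)) (verts (hypercube n))" "\<And>x. g (cls n x) = cls n (flip k x)"
proof
  have id: "bij_betw (\<lambda>i. i) {..n} {..n}" by (auto simp: bij_betw_def)
  show "bij_betw (aff n (\<lambda>i. i = k) (\<lambda>i. i)) (verts (hypercube n)) (verts (hypercube n))"
    using aff_in_Aut[OF id] by (simp add: Aut_carrier Bij_def)
  show "aff n (\<lambda>i. i = k) (\<lambda>i. i) (cls n x) = cls n (flip k x)" for x
    unfolding aff_cls[OF id] by (rule cls_cong) (auto simp: flip_def)
qed

text \<open>When the base vertex runs over the whole cube, every vertex occurs four times, once as
  each corner. The total of the values therefore determines the common face sum.\<close>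

lemma face_sum_total:
  assumes ij: "i \<le> n" "j \<le> n" and faces: "\<And>x. face_sum n f i j x = c"
  shows "4 * sum f (verts (hypercube n)) = 2 ^ n * c"
proof -
  let ?V = "verts (hypercube n)"
  obtain g h where g: "bij_betw g ?V ?V" "\<And>x. g (cls n x) = cls n (flip i x)"
    and h: "bij_betw h ?V ?V" "\<And>x. h (cls n x) = cls n (flip j x)"
    using bij_betw_flip ij by metis
  have "2 ^ n * c = (\<Sum>u\<in>?V. c)" by (simp add: card_verts_hypercube)
  also have "\<dots> = (\<Sum>u\<in>?V. f u + f (g u) + f (h u) + f (g (h u)))"
  proof (rule sum.cong)
    fix u assume "u \<in> ?V"
    then obtain x where "u = cls n x" by (rule cls_cases)
    then show "c = f u + f (g u) + f (h u) + f (g (h u))"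
      using faces[of x] by (simp add: g h face_sum_def)
  qed simp
  also have "\<dots> = sum f ?V + sum f ?V + sum f ?V + sum f ?V"
    using sum.reindex_bij_betw[OF g(1), of f] sum.reindex_bij_betw[OF h(1), of f]
      sum.reindex_bij_betw[OF h(1), of "\<lambda>u. f (g u)"] by (simp add: sum.distrib)
  finally show ?thesis by simp
qed

text \<open>Suppose the weights 1, 2, ..., 2^(k-1) have been found, on a set \<open>J\<close>. By
  binary expansion the subsets of \<open>J\<close> already realise every value below 2^k, so by
  injectivity no other subset has such a value. A subset \<open>S\<close> of sum 2^k exists and is
  not contained in \<open>J\<close>, whose total is 2^k - 1. An element of \<open>S\<close> outside
  \<open>J\<close> then has weight at least 2^k, and as a summand of \<open>S\<close> at most
  2^k.\<close>

lemma binary_weights: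
  fixes d :: "'a \<Rightarrow> real"
  assumes I: "finite I" "card I = n" and d: "\<And>i. i \<in> I \<Longrightarrow> d i \<ge> 0"
    and inj: "inj_on (sum d) (Pow I)" and range: "sum d ` Pow I = real ` {0..<2 ^ n}"
  obtains e where "bij_betw e {..<n} I" "\<And>k. k < n \<Longrightarrow> d (e k) = 2 ^ k"
proof -
  have "\<exists>i\<in>I. d i = 2 ^ k" if "k < n" for k
    using that
  proof (induction k rule: less_induct)
    case (less k)
    then have "\<forall>j<k. \<exists>i\<in>I. d i = 2 ^ j" by auto
    then obtain e where e: "\<And>j. j < k \<Longrightarrow> e j \<in> I \<and> d (e j) = 2 ^ j" by metis
    define J where "J = e ` {..<k}"
    have J: "J \<subseteq> I" using e by (auto simp: J_def)
    have einj: "inj_on e {..<k}"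
    proof (rule inj_onI)
      fix i j assume "i \<in> {..<k}" "j \<in> {..<k}" "e i = e j"
      then have "(2 :: real) ^ i = 2 ^ j" using e by (metis lessThan_iff)
      then show "i = j" by simp
    qed
    have small: "\<exists>T\<subseteq>J. sum d T = real t" if "t < 2 ^ k" for t
    proof -
      have dec: "set_decode t \<subseteq> {..<k}"
      proof
        fix i assume "i \<in> set_decode t"
        then have "2 ^ i \<le> set_encode (set_decode t)"
          unfolding set_encode_def by (intro member_le_sum) auto
        then have "(2 :: nat) ^ i < 2 ^ k" using that by (simp del: power_strict_increasing_iff)
        then show "i \<in> {..<k}" by (simp add: power_less_imp_less_exp)
      qed
      have "sum d (e ` set_decode t) = (\<Sum>j\<in>set_decode t. d (e j))"
        using inj_on_subset[OF einj dec] by (simp add: sum.reindex)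
      also have "\<dots> = (\<Sum>j\<in>set_decode t. 2 ^ j)" using e dec by (intro sum.cong) auto
      also have "\<dots> = real (set_encode (set_decode t))" by (simp add: set_encode_def)
      finally show ?thesis using dec by (intro exI[of _ "e ` set_decode t"]) (auto simp: J_def)
    qed
    have "real (2 ^ k) \<in> real ` {0..<2 ^ n}" using less.prems by (intro imageI) simp
    then obtain S where S: "S \<subseteq> I" "sum d S = 2 ^ k" unfolding range[symmetric] by auto
    have fin: "finite S" "finite J" using S J I finite_subset by blast+
    have nonneg: "sum d T \<ge> 0" if "T \<subseteq> I" for T using that d by (intro sum_nonneg) auto
    have key: "T = {}" if T: "T \<subseteq> S - J" "sum d T < 2 ^ k" for T
    proof -
      obtain N where N: "sum d T = real N"
        using range T S by (metis (no_types) Diff_subset PowI image_iff subset_trans)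
      then obtain T' where T': "T' \<subseteq> J" "sum d T' = sum d T" using small[of N] T by auto
      have "T \<in> Pow I" "T' \<in> Pow I" using T T' S J by auto
      then have "T' = T" using inj_onD[OF inj, of T' T] T'(2) by simp
      then show ?thesis using T T' by blast
    qed
    have "S - J \<noteq> {}"
    proof
      assume "S - J = {}"
      then have "sum d S \<le> sum d J" using J d fin by (intro sum_mono2) auto
      also have "sum d J = (\<Sum>j<k. 2 ^ j)"
        unfolding J_def using einj e by (simp add: sum.reindex)
      also have "\<dots> < 2 ^ k" by (simp add: sum_gp_strict flip: power_Suc)
      finally show False using S by simp
    qed
    then obtain i where i: "i \<in> S - J" by blast
    have le: "sum d T \<le> 2 ^ k" if "T \<subseteq> S" for T
      unfolding S(2)[symmetric] using that fin S d by (intro sum_mono2) auto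
    have "\<not> d i < 2 ^ k" using key[of "{i}"] i by auto
    moreover have "d i \<le> 2 ^ k" using le[of "{i}"] i by auto
    ultimately have "d i = 2 ^ k" by simp
    then show ?case using i S by blast
  qed
  then obtain e where e: "\<And>k. k < n \<Longrightarrow> e k \<in> I \<and> d (e k) = 2 ^ k" by metis
  have "inj_on e {..<n}"
  proof (rule inj_onI)
    fix i j assume "i \<in> {..<n}" "j \<in> {..<n}" "e i = e j"
    then have "(2 :: real) ^ i = 2 ^ j" using e by (metis lessThan_iff)
    then show "i = j" by simp
  qed
  moreover have "e ` {..<n} = I"
    using calculation e I by (intro card_subset_eq) (auto simp: card_image)
  ultimately show thesis using e that by (simp add: bij_betw_def)
qed

section \<open>Bijective labellings with constant 2-face sums\<close>

text \<open>The labellings are constrained on vertices only and are not extensional, so that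
  compositions with \<open>inv_into\<close> or with automorphisms qualify as they stand;
  \<open>x\<close> ranges over all representatives of the base vertex.\<close>

definition face_magic :: "nat \<Rightarrow> ((nat \<Rightarrow> nat) \<Rightarrow> nat) set"
  where "face_magic n = {f. bij_betw f (verts (hypercube n)) {1..2 ^ n} \<and>
    (\<exists>c :: nat. \<forall>x i j. i < n \<and> j < n \<and> i \<noteq> j \<longrightarrow> face_sum n (\<lambda>u. real (f u)) i j x = real c)}"

lemma sum_atLeast1_atMost: "(\<Sum>k=1..N. real k) = real N * (real N + 1) / 2"
  by (induction N) (auto simp: field_simps)

lemma face_magic_amp:
  assumes n: "even n" "n \<ge> 2" and f: "f \<in> face_magic n"
  obtains b where "\<And>x. real (f (cls n x)) = (2 ^ n + 1) / 2 + amp n b x"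
proof -
  obtain c :: nat where bij: "bij_betw f (verts (hypercube n)) {1..2 ^ n}"
    and c: "\<And>x i j. i < n \<Longrightarrow> j < n \<Longrightarrow> i \<noteq> j \<Longrightarrow> face_sum n (\<lambda>u. real (f u)) i j x = real c"
    using f unfolding face_magic_def by blast
  have "(\<Sum>u\<in>verts (hypercube n). real (f u)) = (\<Sum>k=1..2 ^ n. real k)"
    by (rule sum.reindex_bij_betw[OF bij])
  also have "\<dots> = 2 ^ n * (2 ^ n + 1) / 2" unfolding sum_atLeast1_atMost by simp
  finally have tot: "(\<Sum>u\<in>verts (hypercube n). real (f u)) = 2 ^ n * (2 ^ n + 1) / 2" .
  \<comment> \<open>Averaging over the faces in directions 0 and 1 makes \<open>c\<close> four times
    the mean of the entries; \<open>(2 ^ n + 1) / 2\<close> is this mean.\<close>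
  have "2 ^ n * real c = 4 * (\<Sum>u\<in>verts (hypercube n). real (f u))"
    using face_sum_total[of 0 n 1 "\<lambda>u. real (f u)" "real c"] c[of 0 1] n by simp
  also have "\<dots> = 2 ^ n * (2 * (2 ^ n + 1))" unfolding tot by simp
  finally have "real c = 2 * (2 ^ n + 1)" by (subst (asm) mult_cancel_left) simp
  then have "real c = 4 * ((2 ^ n + 1) / 2)" by simp
  then show thesis using amp_if_face_sums[OF n(1), of "\<lambda>u. real (f u)" "(2 ^ n + 1) / 2"] c that by auto
qed

lemma face_magicI:
  assumes "bij_betw f (verts (hypercube n)) {1..2 ^ n}"
    and "\<And>x. real (f (cls n x)) = (2 ^ n + 1) / 2 + amp n b x"
  shows "f \<in> face_magic n"
proof -
  have "face_sum n (\<lambda>u. real (f u)) i j x = real (2 * (2 ^ n + 1))" if "i < n" "j < n" "i \<noteq> j" for x i j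
    using face_sum_amp[OF assms(2), of i j x] that by simp
  then show ?thesis using assms(1) unfolding face_magic_def by blast
qed

text \<open>The argument goes through the weights because \<open>g\<close> need not map 2-faces of
  the cube to 2-faces. The permutation relabels the weights, the translation multiplies each by its
  own sign and all of them by \<open>par n a\<close>; the form is kept, and it implies constant face
  sums.\<close>

lemma face_magic_Aut:
  assumes n: "even n" "n \<ge> 2" and f: "f \<in> face_magic n" and g: "g \<in> carrier (Aut (folded_hypercube n))"
  shows "(\<lambda>u. f (g u)) \<in> face_magic n"
proof -
  obtain b where b: "\<And>x. real (f (cls n x)) = (2 ^ n + 1) / 2 + amp n b x"
    using face_magic_amp[OF n f] by blast
  obtain a \<tau> where \<tau>: "bij_betw \<tau> {..n} {..n}" and ga: "g = aff n a \<tau>"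
    using Aut_folded_hypercube_cases[OF n g] by blast
  let ?t = "inv_into {..n} \<tau>"
  define b' where "b' j = par n a * b (?t j) * sg (a (?t j))" for j
  have "amp n b (\<lambda>i. a i \<noteq> x (\<tau> i)) = amp n b' x" for x
  proof -
    have "(\<Sum>i\<le>n. b i * sg (a i) * sg (x (\<tau> i))) = (\<Sum>i\<le>n. b (?t (\<tau> i)) * sg (a (?t (\<tau> i))) * sg (x (\<tau> i)))"
      using \<tau> by (intro sum.cong) (auto simp: bij_betw_inv_into_left)
    also have "\<dots> = (\<Sum>j\<le>n. b (?t j) * sg (a (?t j)) * sg (x j))"
      by (rule sum.reindex_bij_betw[OF \<tau>, of "\<lambda>j. b (?t j) * sg (a (?t j)) * sg (x j)"])
    finally show ?thesis
      unfolding amp_aff[OF \<tau>] by (simp add: amp_def b'_def sum_distrib_left mult_ac)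
  qed
  then have "real (f (g (cls n x))) = (2 ^ n + 1) / 2 + amp n b' x" for x
    unfolding ga aff_cls[OF \<tau>] b by simp
  moreover have "bij_betw (\<lambda>u. f (g u)) (verts (hypercube n)) {1..2 ^ n}"
    using bij_betw_trans[of g "verts (hypercube n)" "verts (hypercube n)" f "{1..2 ^ n}"] f g
    by (simp add: face_magic_def Aut_carrier Bij_def o_def)
  ultimately show ?thesis by (intro face_magicI)
qed

lemma bij_cls_eqD:
  assumes "bij_betw f (verts (hypercube n)) S" "f (cls n x) = f (cls n y)"
  shows "cls n x = cls n y"
  using assms cls_in_verts inj_onD unfolding bij_betw_def by metis

text \<open>If no weight vanished, only one sign vector \<open>y\<close> would make the weighted sum
  equal to the sum of all absolute values. The entry at \<open>y\<close> has a mirror image about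
  the mean, attained at some class. Its representative with product opposite to that of
  \<open>y\<close> also reaches the maximal sum, hence coincides with \<open>y\<close>, against the
  opposite products.\<close>

lemma amp_zero_weight:
  assumes n: "even n" and bij: "bij_betw f (verts (hypercube n)) {1..2 ^ n}"
    and f: "\<And>x. real (f (cls n x)) = (2 ^ n + 1) / 2 + amp n b x"
  shows "\<exists>i\<le>n. b i = 0"
proof (rule ccontr)
  assume "\<not> ?thesis"
  then have nz: "b i \<noteq> 0" if "i \<le> n" for i using that by blast
  define y where "y i = (b i < 0)" for i
  have bsg: "b i * sg (y i) = \<bar>b i\<bar>" for i by (simp add: y_def sg_def)
  have "f (cls n y) \<in> {1..2 ^ n}" using bij_betw_apply[OF bij] by simp
  then have "2 ^ n + 1 - f (cls n y) \<in> {1..2 ^ n}" by auto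
  then obtain u where "u \<in> verts (hypercube n)" "f u = 2 ^ n + 1 - f (cls n y)"
    using bij unfolding bij_betw_def by (metis imageE)
  then obtain z0 where z0: "f (cls n z0) = 2 ^ n + 1 - f (cls n y)" by (metis cls_cases)
  \<comment> \<open>Passing to the complement reverses the product and keeps the value, so the
    opposite product can always be arranged.\<close>
  define z where "z = (if par n z0 = - par n y then z0 else (\<lambda>i. \<not> z0 i))"
  have pz: "par n z = - par n y"
    using par_cases[of n z0] par_cases[of n y] by (auto simp: z_def par_not n)
  have "amp n b z = amp n b z0" by (simp add: z_def amp_not n)
  also have "\<dots> = real (f (cls n z0)) - (2 ^ n + 1) / 2" by (simp add: f)
  also have "\<dots> = - (real (f (cls n y)) - (2 ^ n + 1) / 2)"
    using \<open>f (cls n y) \<in> {1..2 ^ n}\<close> unfolding z0 by (simp add: of_nat_diff field_simps)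
  also have "\<dots> = - amp n b y" by (simp add: f)
  finally have "(\<Sum>i\<le>n. b i * sg (z i)) = (\<Sum>i\<le>n. \<bar>b i\<bar>)"
    using par_cases[of n y] by (auto simp: amp_def pz bsg)
  then have "(\<Sum>i\<le>n. \<bar>b i\<bar> - b i * sg (z i)) = 0" by (simp add: sum_subtractf)
  moreover have "\<bar>b i\<bar> - b i * sg (z i) \<ge> 0" for i using abs_ge_self[of "b i * sg (z i)"] by (simp add: abs_mult)
  ultimately have "\<forall>i\<in>{..n}. \<bar>b i\<bar> - b i * sg (z i) = 0" by (subst (asm) sum_nonneg_eq_0_iff) auto
  then have "b i * sg (y i) = b i * sg (z i)" if "i \<le> n" for i using bsg that by simp
  then have "y i = z i" if "i \<le> n" for i using nz that by (simp add: sg_eq_iff)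
  then have "par n y = par n z" by (intro par_cong)
  then show False using pz par_cases[of n y] by auto
qed

text \<open>With a zero weight at \<open>z\<close>, the signs elsewhere are free and the product is
  repaired at \<open>z\<close>. Each subset of the other indices then yields one entry, namely the
  largest entry minus a subset sum of the doubled absolute weights; as there are as many subsets as
  entries, these subset sums are 0, ..., 2^n - 1.\<close>

lemma amp_weights:
  assumes n: "even n" and bij: "bij_betw f (verts (hypercube n)) {1..2 ^ n}"
    and f: "\<And>x. real (f (cls n x)) = (2 ^ n + 1) / 2 + amp n b x"
  obtains e where "bij_betw e {..n} {..n}" "b (e n) = 0" "\<And>k. k < n \<Longrightarrow> \<bar>b (e k)\<bar> = 2 ^ k / 2"
proof -
  obtain z where z: "z \<le> n" "b z = 0" using amp_zero_weight[OF assms] by blast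
  define I where "I = {..n} - {z}"
  have I: "finite I" "card I = n" using z by (auto simp: I_def)
  define d where "d i = 2 * \<bar>b i\<bar>" for i
  have "\<exists>y. (\<forall>i. i \<noteq> z \<longrightarrow> y i = ((b i < 0) \<noteq> (i \<in> S))) \<and> par n y = 1" for S
    using ex_par_one[OF z(1), of "\<lambda>i. (b i < 0) \<noteq> (i \<in> S)"] by metis
  \<comment> \<open>The term at \<open>i\<close> contributes plus its absolute value off
    \<open>S\<close> and minus it on \<open>S\<close>; coordinate \<open>z\<close> makes the product
    1.\<close>
  then obtain Y where Y: "\<And>S i. i \<noteq> z \<Longrightarrow> Y S i = ((b i < 0) \<noteq> (i \<in> S))" "\<And>S. par n (Y S) = 1" by metis
  define M where "M = (2 ^ n + 1) / 2 + (\<Sum>i\<in>I. \<bar>b i\<bar>)"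
  have val: "real (f (cls n (Y S))) = M - sum d S" if "S \<subseteq> I" for S
  proof -
    have "(\<Sum>i\<le>n. b i * sg (Y S i)) = (\<Sum>i\<in>I. b i * sg (Y S i))"
      unfolding I_def using z by (intro sum.mono_neutral_right) auto
    also have "\<dots> = (\<Sum>i\<in>I. \<bar>b i\<bar> - (if i \<in> S then d i else 0))"
      by (intro sum.cong) (auto simp: I_def Y(1) d_def sg_def)
    also have "\<dots> = (\<Sum>i\<in>I. \<bar>b i\<bar>) - sum d S"
      using that I(1) by (simp add: sum_subtractf sum.If_cases Int_absorb1)
    finally show ?thesis by (simp add: f amp_def Y(2) M_def)
  qed
  have rng: "f (cls n x) \<in> {1..2 ^ n}" for x using bij_betw_apply[OF bij] by simp
  have inj: "inj_on (sum d) (Pow I)"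
  proof (rule inj_onI)
    fix S T assume ST: "S \<in> Pow I" "T \<in> Pow I" "sum d S = sum d T"
    then have "real (f (cls n (Y S))) = real (f (cls n (Y T)))" using val by auto
    then have "cls n (Y S) = cls n (Y T)" using bij_cls_eqD[OF bij] by simp
    then consider "\<forall>i\<le>n. Y S i = Y T i" | "\<forall>i\<le>n. Y S i \<noteq> Y T i" unfolding cls_eq_iff by blast
    then show "S = T"
    proof cases
      case 1
      have "i \<in> S \<longleftrightarrow> i \<in> T" if "i \<in> I" for i
        using that 1 Y(1)[of i S] Y(1)[of i T] unfolding I_def by auto
      then show ?thesis using ST by blast
    next
      case 2
      \<comment> \<open>Complementary representatives cannot both have product 1.\<close>
      then have "par n (Y S) = par n (\<lambda>i. \<not> Y T i)" by (intro par_cong) auto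
      then show ?thesis by (simp add: par_not n Y(2))
    qed
  qed
  have "real ` {1..2 ^ n} = (\<lambda>S. M - sum d S) ` Pow I"
  proof (rule card_subset_eq[symmetric])
    show "(\<lambda>S. M - sum d S) ` Pow I \<subseteq> real ` {1..2 ^ n}"
      using val rng by (metis (no_types, lifting) PowD image_eqI image_subsetI)
    have "inj_on (\<lambda>S. M - sum d S) (Pow I)" using inj by (simp add: inj_on_def)
    then show "card ((\<lambda>S. M - sum d S) ` Pow I) = card (real ` {1..2 ^ n})"
      using I by (simp add: card_image card_Pow)
  qed simp
  note img = this
  have d0: "sum d S \<ge> 0" for S by (intro sum_nonneg) (simp add: d_def)
  \<comment> \<open>\<open>M\<close> is the value at the empty set and, the \<open>d i\<close> being
    nonnegative, the largest of all values; so it is the largest entry.\<close>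
  have M: "M = 2 ^ n"
  proof (rule antisym)
    have "real (2 ^ n) \<in> real ` {1..2 ^ n}" by (intro imageI) simp
    then obtain S where "real (2 ^ n) = M - sum d S" unfolding img by blast
    then show "2 ^ n \<le> M" using d0[of S] by simp
    have "M \<in> real ` {1..2 ^ n}" unfolding img by (auto intro!: image_eqI[of _ _ "{}"])
    then show "M \<le> 2 ^ n" by auto
  qed
  have "sum d ` Pow I = (\<lambda>r. M - r) ` (\<lambda>S. M - sum d S) ` Pow I"
    unfolding image_image by simp
  also have "\<dots> = (\<lambda>k. 2 ^ n - real k) ` {1..2 ^ n}" by (simp only: img[symmetric]) (simp only: image_image M)
  also have "\<dots> = real ` (\<lambda>k. 2 ^ n - k) ` {1..2 ^ n}"
    unfolding image_image by (intro image_cong refl) (simp add: of_nat_diff)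
  also have "(\<lambda>k. 2 ^ n - k) ` {1..2 ^ n} = {0..<2 ^ n :: nat}"
  proof (intro equalityI subsetI)
    fix k :: nat assume "k \<in> {0..<2 ^ n}"
    then show "k \<in> (\<lambda>k. 2 ^ n - k) ` {1..2 ^ n}" by (intro image_eqI[of _ _ "2 ^ n - k"]) auto
  qed auto
  finally have range: "sum d ` Pow I = real ` {0..<2 ^ n}" .
  obtain e where e: "bij_betw e {..<n} I" "\<And>k. k < n \<Longrightarrow> d (e k) = 2 ^ k"
    using binary_weights[OF I _ inj range] by (auto simp: d_def)
  \<comment> \<open>Index \<open>n\<close> is reserved for the zero weight, so that any two
    solutions enumerate their weights in matching order.\<close>
  define e' where "e' = e(n := z)"
  have "bij_betw e' {..<n} I" using e(1) by (rule bij_betw_cong[THEN iffD1, rotated]) (simp add: e'_def)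
  then have "bij_betw e' ({..<n} \<union> {n}) (I \<union> {e' n})"
    by (subst notIn_Un_bij_betw3[symmetric]) (auto simp: I_def e'_def)
  moreover have "{..<n} \<union> {n} = {..n}" "I \<union> {e' n} = {..n}" using z by (auto simp: I_def e'_def)
  ultimately have "bij_betw e' {..n} {..n}" by simp
  moreover have "b (e' n) = 0" using z by (simp add: e'_def)
  moreover have "\<bar>b (e' k)\<bar> = 2 ^ k / 2" if "k < n" for k using e(2)[OF that] that by (simp add: e'_def d_def)
  ultimately show thesis by (rule that)
qed

text \<open>\<open>\<tau>\<close> matches weights of equal absolute value and \<open>a\<close>
  corrects their signs. By \<open>amp_aff\<close> all weights also acquire the factor
  \<open>par n a\<close>, so \<open>a\<close> must have product 1; at \<open>e n\<close> both
  weights vanish, which leaves that entry of \<open>a\<close> free for the purpose.\<close>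

lemma face_magic_transitive:
  assumes n: "even n" "n \<ge> 2" and f: "f \<in> face_magic n" and f': "f' \<in> face_magic n"
  shows "\<exists>g\<in>carrier (Aut (folded_hypercube n)). \<forall>u\<in>verts (hypercube n). f' u = f (g u)"
proof -
  obtain b where b: "\<And>x. real (f (cls n x)) = (2 ^ n + 1) / 2 + amp n b x"
    using face_magic_amp[OF n f] by blast
  obtain b' where b': "\<And>x. real (f' (cls n x)) = (2 ^ n + 1) / 2 + amp n b' x"
    using face_magic_amp[OF n f'] by blast
  obtain e where e: "bij_betw e {..n} {..n}" "b (e n) = 0" "\<And>k. k < n \<Longrightarrow> \<bar>b (e k)\<bar> = 2 ^ k / 2"
    using amp_weights[OF n(1) _ b] f unfolding face_magic_def by blast
  obtain e' where e': "bij_betw e' {..n} {..n}" "b' (e' n) = 0" "\<And>k. k < n \<Longrightarrow> \<bar>b' (e' k)\<bar> = 2 ^ k / 2"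
    using amp_weights[OF n(1) _ b'] f' unfolding face_magic_def by blast
  define \<tau> where "\<tau> = e' \<circ> inv_into {..n} e"
  have \<tau>: "bij_betw \<tau> {..n} {..n}"
    unfolding \<tau>_def by (rule bij_betw_trans[OF bij_betw_inv_into[OF e(1)] e'(1)])
  have en: "e n \<le> n" using bij_betw_apply[OF e(1), of n] by simp
  have \<tau>e: "\<tau> (e k) = e' k" if "k \<le> n" for k
    using bij_betw_inv_into_left[OF e(1), of k] that by (simp add: \<tau>_def)
  obtain a where a: "\<And>i. i \<noteq> e n \<Longrightarrow> a i = ((b i < 0) \<noteq> (b' (\<tau> i) < 0))" "par n a = 1"
    using ex_par_one[OF en, of "\<lambda>i. (b i < 0) \<noteq> (b' (\<tau> i) < 0)"] by metis
  have w: "b i * sg (a i) = b' (\<tau> i)" if i: "i \<le> n" for i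
  proof -
    have "i \<in> e ` {..n}" using e(1) i unfolding bij_betw_def by simp
    then obtain k where k: "k \<le> n" "i = e k" by auto
    show ?thesis
    proof (cases "k = n")
      case True then show ?thesis using k e(2) e'(2) \<tau>e by simp
    next
      case False
      then have "k < n" using k by simp
      then have abs: "\<bar>b i\<bar> = \<bar>b' (\<tau> i)\<bar>" using e(3)[of k] e'(3)[of k] \<tau>e[of k] k by simp
      have "i \<noteq> e n" using e(1) k False by (auto simp: bij_betw_def inj_on_def)
      then show ?thesis using abs a(1) by (auto simp: sg_def abs_if split: if_splits)
    qed
  qed
  have "f' (cls n x) = f (aff n a \<tau> (cls n x))" for x
  proof -
    have "(\<Sum>i\<le>n. b i * sg (a i) * sg (x (\<tau> i))) = (\<Sum>i\<le>n. b' (\<tau> i) * sg (x (\<tau> i)))"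
      by (intro sum.cong) (auto simp: w)
    also have "\<dots> = (\<Sum>i\<le>n. b' i * sg (x i))"
      by (rule sum.reindex_bij_betw[OF \<tau>, of "\<lambda>i. b' i * sg (x i)"])
    finally have "amp n b (\<lambda>i. a i \<noteq> x (\<tau> i)) = amp n b' x"
      unfolding amp_aff[OF \<tau>] by (simp add: a amp_def)
    then have "real (f' (cls n x)) = real (f (aff n a \<tau> (cls n x)))"
      unfolding aff_cls[OF \<tau>] b b' by simp
    then show ?thesis by simp
  qed
  then have "\<forall>u\<in>verts (hypercube n). f' u = f (aff n a \<tau> u)" by (metis cls_cases)
  then show ?thesis using aff_in_Aut[OF \<tau>] by blast
qed

text \<open>The labelling is the symmetric form with weights \<open>2 ^ i / 2\<close> for
  \<open>i < n\<close> and 0 at \<open>n\<close>, read in binary: on the representative of product 1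
  the first \<open>n\<close> bits form a number that is subtracted from \<open>2 ^ n\<close>. These
  bits determine the last one through the product, whence injectivity.\<close>

lemma face_magic_nonempty:
  assumes n: "even n"
  shows "face_magic n \<noteq> {}"
proof -
  let ?V = "verts (hypercube n)"
  have "\<exists>y. cls n y = u \<and> par n y = 1" if u: "u \<in> ?V" for u
  proof -
    obtain x where x: "u = cls n x" using u by (rule cls_cases)
    have "cls n (\<lambda>i. \<not> x i) = cls n x" by (simp add: cls_eq_iff)
    then show ?thesis using par_cases[of n x] par_not[OF n, of x] x by force
  qed
  then obtain Y where Y: "\<And>u. u \<in> ?V \<Longrightarrow> cls n (Y u) = u \<and> par n (Y u) = 1" by metis
  define Z where "Z u = {i. i < n \<and> Y u i}" for u
  define f where "f u = 2 ^ n - set_encode (Z u)" for u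
  have Zn: "Z u \<subseteq> {..<n}" for u by (auto simp: Z_def)
  have fin: "finite (Z u)" for u using Zn finite_subset by blast
  have tot: "set_encode {..<n} = 2 ^ n - 1" by (simp add: set_encode_def mask_eq_sum_exp_nat lessThan_def)
  have le: "set_encode (Z u) < 2 ^ n" for u
  proof -
    have "set_encode (Z u) \<le> set_encode {..<n}"
      unfolding set_encode_def using Zn by (intro sum_mono2) auto
    then show ?thesis unfolding tot by (meson le_less_trans diff_less zero_less_one pos2 zero_less_power)
  qed
  have inj: "inj_on f ?V"
  proof (rule inj_onI)
    fix u v assume u: "u \<in> ?V" and v: "v \<in> ?V" and eq: "f u = f v"
    have "set_encode (Z u) = set_encode (Z v)" using eq le[of u] le[of v] by (simp add: f_def)
    then have ZZ: "Z u = Z v" using fin by (simp add: set_encode_eq)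
    then have lt: "Y u i = Y v i" if "i < n" for i using that unfolding Z_def by blast
    have "Y u n = Y v n"
    proof -
      have p: "par n (Y w) = (\<Prod>i<n. sg (Y w i)) * sg (Y w n)" for w
        by (simp add: par_def lessThan_Suc_atMost[symmetric])
      have "(\<Prod>i<n. sg (Y u i)) = (\<Prod>i<n. sg (Y v i))" using lt by (intro prod.cong) auto
      moreover have "(\<Prod>i<n. sg (Y v i)) * sg (Y v n) = 1" "(\<Prod>i<n. sg (Y u i)) * sg (Y u n) = 1"
        using Y u v p by metis+
      ultimately have "sg (Y u n) = sg (Y v n)" by (metis mult_cancel_left mult_zero_left zero_neq_one)
      then show ?thesis by (simp add: sg_eq_iff)
    qed
    then have "cls n (Y u) = cls n (Y v)" using lt by (intro cls_cong) (auto simp: le_less)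
    then show "u = v" using Y u v by metis
  qed
  have "f ` ?V \<subseteq> {1..2 ^ n}" using le by (auto simp: f_def Suc_le_eq)
  moreover have "card (f ` ?V) = card {1..(2::nat) ^ n}"
    using inj by (simp add: card_image card_verts_hypercube)
  ultimately have bij: "bij_betw f ?V {1..2 ^ n}"
    using inj by (simp add: bij_betw_def card_subset_eq)
  define b where "b i = (if i < n then 2 ^ i / 2 else (0 :: real))" for i
  have "real (f (cls n x)) = (2 ^ n + 1) / 2 + amp n b x" for x
  proof -
    let ?u = "cls n x"
    have Yx: "cls n (Y ?u) = cls n x" "par n (Y ?u) = 1" using Y by auto
    have geo: "(\<Sum>i<n. 2 ^ i) = (2 ^ n - 1 :: real)" by (simp add: sum_gp_strict)
    have "amp n b x = amp n b (Y ?u)" using amp_cls[OF n Yx(1)] by simp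
    also have "\<dots> = (\<Sum>i<n. 2 ^ i / 2 * sg (Y ?u i))"
      by (simp add: amp_def Yx(2) lessThan_Suc_atMost[symmetric] b_def)
    also have "\<dots> = (\<Sum>i<n. 2 ^ i / 2 - (if Y ?u i then 2 ^ i else 0))"
      by (intro sum.cong) (auto simp: sg_def)
    also have "\<dots> = (2 ^ n - 1) / 2 - (\<Sum>i<n. if Y ?u i then 2 ^ i else 0)"
      by (simp add: sum_subtractf geo flip: sum_divide_distrib)
    also have "(\<Sum>i<n. if Y ?u i then 2 ^ i else 0) = real (set_encode (Z ?u))"
      unfolding set_encode_def Z_def by (simp add: sum.inter_filter[symmetric] lessThan_def)
    also have "real (set_encode (Z ?u)) = 2 ^ n - real (f ?u)"
      using le[of ?u] by (simp add: f_def of_nat_diff)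
    finally show ?thesis by (simp add: field_simps)
  qed
  then have "f \<in> face_magic n" using face_magicI[OF bij] by blast
  then show ?thesis by blast
qed

section \<open>Lines and subsquares as 4-cycles\<close>

text \<open>Phrased by adjacency alone, so that any graph isomorphism transports it. Consecutive
  vertices differ because the graphs considered have no loops, which together with the two
  inequalities makes all four distinct.\<close>

definition four_cycle :: "'a ugraph \<Rightarrow> 'a set \<Rightarrow> bool"
  where "four_cycle G S \<longleftrightarrow> (\<exists>a b c d. {a, b, c, d} \<subseteq> verts G \<and> a \<noteq> c \<and> b \<noteq> d \<and>
    {a, b} \<in> edges G \<and> {b, c} \<in> edges G \<and> {c, d} \<in> edges G \<and> {d, a} \<in> edges G \<and> S = {a, b, c, d})"

lemma four_cycleI:
  "{a, b, c, d} \<subseteq> verts G \<Longrightarrow> a \<noteq> c \<Longrightarrow> b \<noteq> d \<Longrightarrow> {a, b} \<in> edges G \<Longrightarrow> {b, c} \<in> edges G \<Longrightarrow>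
   {c, d} \<in> edges G \<Longrightarrow> {d, a} \<in> edges G \<Longrightarrow> four_cycle G {a, b, c, d}"
  unfolding four_cycle_def by blast

lemma four_cycle_subset: "four_cycle G S \<Longrightarrow> S \<subseteq> verts G"
  unfolding four_cycle_def by blast

lemma four_cycle_iso_image:
  assumes iso: "graph_iso G H \<phi>" and "four_cycle G S"
  shows "four_cycle H (\<phi> ` S)"
proof -
  obtain a b c d where V: "{a, b, c, d} \<subseteq> verts G" and ne: "a \<noteq> c" "b \<noteq> d"
    and E: "{a, b} \<in> edges G" "{b, c} \<in> edges G" "{c, d} \<in> edges G" "{d, a} \<in> edges G"
    and S: "S = {a, b, c, d}"
    using assms(2) unfolding four_cycle_def by blast
  have inj: "inj_on \<phi> (verts G)" and img: "\<phi> ` verts G = verts H"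
    using iso by (auto simp: graph_iso_def bij_betw_def)
  have edge: "{u, v} \<in> edges G \<longleftrightarrow> {\<phi> u, \<phi> v} \<in> edges H" if "u \<in> verts G" "v \<in> verts G" for u v
    using iso that by (simp add: graph_iso_def)
  have "four_cycle H {\<phi> a, \<phi> b, \<phi> c, \<phi> d}"
    using V ne E inj img edge by (intro four_cycleI) (auto dest: inj_onD)
  then show ?thesis by (simp add: S)
qed

lemma graph_iso_inv:
  assumes "graph_iso G H \<phi>"
  shows "graph_iso H G (inv_into (verts G) \<phi>)"
proof -
  let ?i = "inv_into (verts G) \<phi>"
  have bij: "bij_betw \<phi> (verts G) (verts H)" using assms by (simp add: graph_iso_def)
  then have bi: "bij_betw ?i (verts H) (verts G)" by (rule bij_betw_inv_into)
  have "{u, v} \<in> edges H \<longleftrightarrow> {?i u, ?i v} \<in> edges G" if "u \<in> verts H" "v \<in> verts H" for u v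
  proof -
    have "\<phi> (?i u) = u" "\<phi> (?i v) = v" using bij that by (simp_all add: bij_betw_inv_into_right)
    moreover have "?i u \<in> verts G" "?i v \<in> verts G" using bij_betw_apply[OF bi] that by auto
    ultimately show ?thesis using assms unfolding graph_iso_def by metis
  qed
  with bi show ?thesis by (simp add: graph_iso_def)
qed

text \<open>A closed walk flips directions \<open>i\<close>, \<open>j\<close>, \<open>k\<close>,
  \<open>l\<close> in turn. None of them is \<open>n\<close>, so returning to the same class means
  returning to the same vector, and every direction occurs an even number of times. Since neither
  \<open>i\<close> nor \<open>k\<close> equals \<open>j\<close>, the pairing is \<open>l = j\<close>
  and \<open>k = i\<close>.\<close>

lemma four_cycle_hypercube:
  "four_cycle (hypercube n) S \<longleftrightarrow> (\<exists>x i j. i < n \<and> j < n \<and> i \<noteq> j \<and>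
    S = {cls n x, cls n (flip i x), cls n (flip i (flip j x)), cls n (flip j x)})" (is "_ \<longleftrightarrow> ?R")
proof
  assume "four_cycle (hypercube n) S"
  then obtain a b c d where V: "a \<in> verts (hypercube n)" "b \<in> verts (hypercube n)" "c \<in> verts (hypercube n)" "d \<in> verts (hypercube n)"
    and ne: "a \<noteq> c" "b \<noteq> d"
    and E: "{a, b} \<in> edges (hypercube n)" "{b, c} \<in> edges (hypercube n)" "{c, d} \<in> edges (hypercube n)" "{d, a} \<in> edges (hypercube n)"
    and S: "S = {a, b, c, d}"
    unfolding four_cycle_def by blast
  have nb: "\<exists>k<n. v = cls n (flip k x)" if "{cls n x, v} \<in> edges (hypercube n)" "v \<in> verts (hypercube n)" for x v
    using that(2,1) by (elim cls_cases) (simp add: edge_hypercube_iff)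
  obtain x where a: "a = cls n x" using V(1) by (rule cls_cases)
  obtain i where i: "i < n" "b = cls n (flip i x)" using nb[OF E(1)[unfolded a] V(2)] by blast
  obtain j where j: "j < n" "c = cls n (flip j (flip i x))" using nb[OF E(2)[unfolded i(2)] V(3)] by blast
  obtain k where k: "k < n" "d = cls n (flip k (flip j (flip i x)))" using nb[OF E(3)[unfolded j(2)] V(4)] by blast
  obtain l where l: "l < n" "a = cls n (flip l (flip k (flip j (flip i x))))" using nb[OF E(4)[unfolded k(2)] V(1)] by blast
  have ij: "i \<noteq> j" using ne(1) a j by auto
  have jk: "k \<noteq> j" using ne(2) i k by auto
  have eq: "flip l (flip k (flip j (flip i x))) e = x e" if "e \<le> n" for e
  proof (rule cls_eqD[of n _ _ n])
    show "cls n (flip l (flip k (flip j (flip i x)))) = cls n x" using l a by simp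
    show "flip l (flip k (flip j (flip i x))) n = x n" using i j k l by (simp add: flip_def)
  qed (use that in auto)
  have "l = j" using eq[of j] j ij jk by (auto simp: flip_def split: if_splits)
  then have "k = i" using eq[of i] i ij jk by (auto simp: flip_def split: if_splits)
  then have "d = cls n (flip j x)" using k(2) by (simp add: flip_commute[of j i])
  then have "S = {cls n x, cls n (flip i x), cls n (flip i (flip j x)), cls n (flip j x)}"
    using S a i j by (simp add: flip_commute[of j i])
  then show ?R using i j ij by blast
next
  assume ?R
  then obtain x i j where ij: "i < n" "j < n" "i \<noteq> j"
    and S: "S = {cls n x, cls n (flip i x), cls n (flip i (flip j x)), cls n (flip j x)}" by blast
  have E: "{cls n y, cls n (flip k y)} \<in> edges (hypercube n)" if "k < n" for y k
    using that edge_hypercube_iff by blast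
  show "four_cycle (hypercube n) S" unfolding S
  proof (rule four_cycleI)
    show "cls n x \<noteq> cls n (flip i (flip j x))"
      using ij cls_eqD[of n x "flip i (flip j x)" n i] by (auto simp: flip_def)
    show "cls n (flip i x) \<noteq> cls n (flip j x)"
      using ij cls_eqD[of n "flip i x" "flip j x" n i] by (auto simp: flip_def)
    show "{cls n (flip i x), cls n (flip i (flip j x))} \<in> edges (hypercube n)"
      using E[OF ij(2), of "flip i x"] by (simp add: flip_commute[of j i])
    show "{cls n (flip i (flip j x)), cls n (flip j x)} \<in> edges (hypercube n)"
      using E[OF ij(1), of "flip j x"] by (simp add: insert_commute)
    show "{cls n (flip j x), cls n x} \<in> edges (hypercube n)"
      using E[OF ij(2), of x] by (simp add: insert_commute)
  qed (use E ij in auto)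
qed

text \<open>A sum over a set counts coinciding elements once, so the point is that the four corners
  are distinct; any two of them differ at \<open>i\<close> or at \<open>j\<close> and agree at
  \<open>n\<close>.\<close>

lemma sum_face:
  assumes ij: "i < n" "j < n" "i \<noteq> j"
  shows "sum f {cls n x, cls n (flip i x), cls n (flip i (flip j x)), cls n (flip j x)} = face_sum n f i j x"
proof -
  have ne: "cls n y \<noteq> cls n z" if "y n = z n" "y k \<noteq> z k" "k < n" for y z k
    using that cls_eqD[of n y z n k] by auto
  have "cls n x \<noteq> cls n (flip i x)" "cls n x \<noteq> cls n (flip i (flip j x))"
    "cls n (flip i x) \<noteq> cls n (flip j x)" "cls n (flip j x) \<noteq> cls n (flip i (flip j x))"
    using ij by (simp_all add: ne[of _ _ i] flip_def)
  moreover have "cls n x \<noteq> cls n (flip j x)" "cls n (flip i x) \<noteq> cls n (flip i (flip j x))"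
    using ij by (simp_all add: ne[of _ _ j] flip_def)
  ultimately show ?thesis by (simp add: face_sum_def)
qed

section \<open>Four-cycles of the toroidal grid\<close>

lemma verts_grid: "verts (cartesian_power m cycle4) = positions m"
  by (simp add: cartesian_power_def positions_def cycle4_def)

lemma positions_upd: "p \<in> positions m \<Longrightarrow> j < m \<Longrightarrow> x < 4 \<Longrightarrow> p(j := x) \<in> positions m"
  by (auto simp: positions_def PiE_iff extensional_def)

lemma edges_cycle4_iff: "{x, y} \<in> edges cycle4 \<longleftrightarrow> (\<exists>a<4. {x, y} = {a, (a + 1) mod 4})"
  by (auto simp: cycle4_def)

lemma edge_cycle4D:
  assumes "{x, y} \<in> edges cycle4"
  shows "x \<noteq> y" "x < 4" "y < 4"
  using assms unfolding cycle4_edges by (auto simp: doubleton_eq_iff)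

lemma edge_grid_iff:
  assumes p: "p \<in> positions m" and q: "q \<in> positions m"
  shows "{p, q} \<in> edges (cartesian_power m cycle4) \<longleftrightarrow>
    (\<exists>j y. j < m \<and> {p j, y} \<in> edges cycle4 \<and> q = p(j := y))"
proof
  have *: "\<exists>j y. j < m \<and> {p j, y} \<in> edges cycle4 \<and> q = p(j := y)"
    if "j < m" "{p j, q j} \<in> edges cycle4" "\<forall>i<m. i \<noteq> j \<longrightarrow> p i = q i" for j
  proof (intro exI conjI)
    show "q = p(j := q j)"
    proof
      fix i
      show "q i = (p(j := q j)) i"
      proof (cases "i < m")
        case False
        then have "p i = undefined" "q i = undefined"
          using p q unfolding positions_def by (auto simp: PiE_iff extensional_def)
        then show ?thesis by auto
      qed (use that(3) in simp)
    qed
  qed (use that in auto)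
  assume "{p, q} \<in> edges (cartesian_power m cycle4)"
  then obtain p' q' j where "{p, q} = {p', q'}" and j: "j < m" "{p' j, q' j} \<in> edges cycle4"
      "\<forall>i<m. i \<noteq> j \<longrightarrow> p' i = q' i"
    unfolding cartesian_power_def ugraph.simps mem_Collect_eq by metis
  then have "p = p' \<and> q = q' \<or> p = q' \<and> q = p'" by (simp only: doubleton_eq_iff)
  then have "{p j, q j} \<in> edges cycle4" "\<forall>i<m. i \<noteq> j \<longrightarrow> p i = q i"
    using j by (auto simp: insert_commute)
  then show "\<exists>j y. j < m \<and> {p j, y} \<in> edges cycle4 \<and> q = p(j := y)" using * j(1) by blast
next
  assume "\<exists>j y. j < m \<and> {p j, y} \<in> edges cycle4 \<and> q = p(j := y)"
  then obtain j y where j: "j < m" "{p j, y} \<in> edges cycle4" "q = p(j := y)" by blast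
  have "\<exists>j<m. {p j, q j} \<in> edges cycle4 \<and> (\<forall>i<m. i \<noteq> j \<longrightarrow> p i = q i)"
    using j by (intro exI[of _ j]) simp
  moreover have "p \<in> {..<m} \<rightarrow>\<^sub>E verts cycle4" "q \<in> {..<m} \<rightarrow>\<^sub>E verts cycle4"
    using p q by (simp_all add: positions_def cycle4_def)
  ultimately show "{p, q} \<in> edges (cartesian_power m cycle4)"
    unfolding cartesian_power_def ugraph.simps mem_Collect_eq
    by - (rule exI[of _ p], rule exI[of _ q], intro conjI refl)
qed

lemma edge_grid_upd:
  assumes "p \<in> positions m" "j < m" "{p j, y} \<in> edges cycle4"
  shows "{p, p(j := y)} \<in> edges (cartesian_power m cycle4)"
  using assms edge_grid_iff[OF assms(1) positions_upd[OF assms(1,2) edge_cycle4D(3)[OF assms(3)]]] by blast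

lemma four_cycle_if_line:
  assumes "S \<in> orthogonal_lines m"
  shows "four_cycle (cartesian_power m cycle4) S"
proof -
  obtain p j where p: "p \<in> positions m" "j < m" and S: "S = {p(j := x) | x. x < 4}"
    using assms unfolding orthogonal_lines_def by blast
  have "S = (\<lambda>x. p(j := x)) ` {..<4}" unfolding S by auto
  also have "{..<4 :: nat} = {0, 1, 2, 3}" by auto
  finally have S': "S = {p(j := 0), p(j := 1), p(j := 2), p(j := 3)}"
    by (simp only: image_insert image_empty)
  have ne: "p(j := x) \<noteq> p(j := y)" if "x \<noteq> y" for x y using that by (metis fun_upd_same)
  have E: "{p(j := x), p(j := y)} \<in> edges (cartesian_power m cycle4)" if "{x, y} \<in> edges cycle4" for x y
    using edge_grid_upd[of "p(j := x)" m j y] that p edge_cycle4D[OF that] by (simp add: positions_upd)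
  show ?thesis
    unfolding S' by (rule four_cycleI) (auto simp: verts_grid positions_upd p ne intro!: E, auto simp: cycle4_edges)
qed

lemma four_cycle_if_subsquare:
  assumes "S \<in> subsquares m"
  shows "four_cycle (cartesian_power m cycle4) S"
proof -
  obtain p j k a b where p: "p \<in> positions m" "j < m" "k < m" "j \<noteq> k" "a < 4" "b < 4"
    and S: "S = {p(j := x, k := y) | x y. x \<in> {a, (a + 1) mod 4} \<and> y \<in> {b, (b + 1) mod 4}}"
    using assms unfolding subsquares_def by blast
  define a' b' where ab': "a' = (a + 1) mod 4" "b' = (b + 1) mod 4"
  have ea: "{a, a'} \<in> edges cycle4" and eb: "{b, b'} \<in> edges cycle4"
    using p by (auto simp: edges_cycle4_iff ab')
  note da = edge_cycle4D[OF ea] and db = edge_cycle4D[OF eb]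
  have S': "S = {p(j := a, k := b), p(j := a', k := b), p(j := a', k := b'), p(j := a, k := b')}"
    unfolding S ab'[symmetric] by blast
  have P: "p(j := x, k := y) \<in> positions m" if "x < 4" "y < 4" for x y
    using p that by (intro positions_upd)
  have E1: "{p(j := x, k := y), p(j := x', k := y)} \<in> edges (cartesian_power m cycle4)"
    if "{x, x'} \<in> edges cycle4" "y < 4" for x x' y
    using edge_grid_upd[of "p(j := x, k := y)" m j x'] that p edge_cycle4D[OF that(1)]
    by (simp add: P fun_upd_twist)
  have E2: "{p(j := x, k := y), p(j := x, k := y')} \<in> edges (cartesian_power m cycle4)"
    if "{y, y'} \<in> edges cycle4" "x < 4" for x y y'
    using edge_grid_upd[of "p(j := x, k := y)" m k y'] that p edge_cycle4D[OF that(1)]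
    by (simp add: P)
  have ne: "p(j := x, k := y) \<noteq> p(j := x', k := y')" if "x \<noteq> x'" for x x' y y'
    using that p(4) by (metis fun_upd_apply)
  show ?thesis
    unfolding S'
  proof (rule four_cycleI)
    show "{p(j := a, k := b), p(j := a', k := b), p(j := a', k := b'), p(j := a, k := b')} \<subseteq> verts (cartesian_power m cycle4)"
      using P da db by (simp add: verts_grid)
  qed (use ne E1 E2 ea eb da db in \<open>auto simp: insert_commute\<close>)
qed

text \<open>If the first two steps go in the same direction, the remaining two must as well, and the
  walk goes once around a copy of the 4-cycle: a line. If they go in different directions, the last
  two steps undo them in the same order and the walk bounds a subsquare, possibly a wrap-around
  one.\<close>

lemma four_cycle_gridD:
  assumes "four_cycle (cartesian_power m cycle4) S"
  shows "S \<in> orthogonal_lines m \<union> subsquares m"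
proof -
  let ?E = "edges (cartesian_power m cycle4)"
  obtain a b c d where V: "a \<in> positions m" "b \<in> positions m" "c \<in> positions m" "d \<in> positions m"
    and ne: "a \<noteq> c" "b \<noteq> d"
    and E: "{a, b} \<in> ?E" "{b, c} \<in> ?E" "{c, d} \<in> ?E" "{d, a} \<in> ?E"
    and S: "S = {a, b, c, d}"
    using assms unfolding four_cycle_def verts_grid by blast
  obtain i y1 where i: "i < m" "{a i, y1} \<in> edges cycle4" "b = a(i := y1)"
    using E(1) edge_grid_iff[OF V(1,2)] by blast
  obtain j y2 where j: "j < m" "{b j, y2} \<in> edges cycle4" "c = b(j := y2)"
    using E(2) edge_grid_iff[OF V(2,3)] by blast
  obtain k y3 where k: "k < m" "{c k, y3} \<in> edges cycle4" "d = c(k := y3)"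
    using E(3) edge_grid_iff[OF V(3,4)] by blast
  obtain l y4 where l: "l < m" "{d l, y4} \<in> edges cycle4" "a = d(l := y4)"
    using E(4) edge_grid_iff[OF V(4,1)] by blast
  note e1 = edge_cycle4D[OF i(2)] and e2 = edge_cycle4D[OF j(2)]
    and e3 = edge_cycle4D[OF k(2)] and e4 = edge_cycle4D[OF l(2)]
  have dl: "d e = a e" if "e \<noteq> l" for e using that l(3) by (metis fun_upd_other)
  have dl': "d l \<noteq> a l" using e4(1) l(3) by (metis fun_upd_same)
  show ?thesis
  proof (cases "i = j")
    case True
    have c: "c = a(i := y2)" using i j True by simp
    have y2: "y2 \<noteq> a i" using ne(1) c by auto
    have ki: "k = i"
    proof (rule ccontr)
      assume "k \<noteq> i"
      then have "d i = y2" "d k \<noteq> a k" using k c e3(1) by auto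
      then show False using dl y2 \<open>k \<noteq> i\<close> by metis
    qed
    then have d: "d = a(i := y3)" using k c by simp
    have "a i \<noteq> y3" using d dl' by (metis fun_upd_triv)
    moreover have "y1 \<noteq> y3" using ne(2) d i by blast
    moreover have "y1 \<noteq> y2" using e2(1) True i(3) by simp
    moreover have "y2 \<noteq> y3" using e3(1) ki c by simp
    \<comment> \<open>Four different residues exhaust the coordinate, so the walk covers the whole
      line.\<close>
    ultimately have "card {a i, y1, y2, y3} = card {..<4::nat}" using e1(1) y2 by simp
    then have "{a i, y1, y2, y3} = {..<4}"
      using e1 e2 e3 by (intro card_subset_eq) auto
    then have "(\<lambda>x. a(i := x)) ` {..<4} = (\<lambda>x. a(i := x)) ` {a i, y1, y2, y3}" by simp
    also have "\<dots> = S" unfolding S c d i(3) by (simp only: image_insert image_empty fun_upd_triv)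
    finally have "S = {a(i := x) | x. x < 4}" by auto
    then show ?thesis using V(1) i(1) unfolding orthogonal_lines_def by blast
  next
    case False
    have bj: "b j = a j" "b i = y1" using i False by auto
    have c: "c i = y1" "c j = y2" using j False bj by auto
    \<comment> \<open>Otherwise coordinate \<open>i\<close> still has to be restored by the last
      step, so the third step must restore \<open>j\<close>; but then the walk is back at
      \<open>b\<close>, against \<open>b \<noteq> d\<close>.\<close>
    have "k = i"
    proof (rule ccontr)
      assume "k \<noteq> i"
      then have "d i \<noteq> a i" using k(3) c e1(1) by auto
      then have li: "l = i" using dl by metis
      have "k = j"
      proof (rule ccontr)
        assume "k \<noteq> j"
        then have "d j \<noteq> a j" using k(3) c e2(1) bj by auto
        then show False using dl li False by metis
      qed
      then have "y3 = a j" using dl[of j] li False k(3) by simp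
      then have "d = b" using \<open>k = j\<close> k(3) j(3) bj by auto
      then show False using ne by simp
    qed
    then have "d j \<noteq> a j" using k(3) c e2(1) bj False by auto
    then have "l = j" using dl by metis
    then have "y3 = a i" using dl[of i] False k(3) \<open>k = i\<close> by simp
    then have d: "d = a(j := y2)" using \<open>k = i\<close> k(3) j(3) i(3) False by auto
    obtain \<alpha> where \<alpha>: "\<alpha> < 4" "{a i, y1} = {\<alpha>, (\<alpha> + 1) mod 4}" using i(2) edges_cycle4_iff by blast
    obtain \<beta> where \<beta>: "\<beta> < 4" "{a j, y2} = {\<beta>, (\<beta> + 1) mod 4}" using j(2) bj(1) edges_cycle4_iff by metis
    have "S = {a(i := x, j := y) | x y. x \<in> {a i, y1} \<and> y \<in> {a j, y2}}"
    proof -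
      have "{a(i := x, j := y) | x y. x \<in> {a i, y1} \<and> y \<in> {a j, y2}} =
        {a(i := a i, j := a j), a(i := y1, j := a j), a(i := y1, j := y2), a(i := a i, j := y2)}" by blast
      also have "a(i := y1, j := a j) = b" unfolding i(3) using False by (intro ext) simp
      also have "a(i := y1, j := y2) = c" using i(3) j(3) by simp
      finally show ?thesis unfolding S d by (simp only: fun_upd_triv)
    qed
    then show ?thesis unfolding \<alpha> \<beta> using V(1) i(1) j(1) False \<alpha>(1) \<beta>(1) unfolding subsquares_def by blast
  qed
qed

lemma four_cycle_grid: "four_cycle (cartesian_power m cycle4) S \<longleftrightarrow> S \<in> orthogonal_lines m \<union> subsquares m"
  using four_cycle_gridD four_cycle_if_line four_cycle_if_subsquare by blast

text \<open>Lines and subsquares together are the 4-cycles of the grid, and the 2-faces are those of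
  the cube, so every isomorphism \<open>\<phi>\<close> exchanges the two families, whichever one is
  fixed. For \<open>m = 1\<close> there are no subsquares, and the only line is matched with the
  whole square.\<close>

lemma compact_magic_hypercubes_iff:
  assumes iso: "graph_iso (cartesian_power m cycle4) (hypercube (2 * m)) \<phi>"
  shows "A \<in> compact_magic_hypercubes m \<longleftrightarrow> A \<in> extensional (positions m) \<and>
    (\<lambda>u. A (inv_into (positions m) \<phi> u)) \<in> face_magic (2 * m)"
proof -
  let ?X = "positions m" and ?n = "2 * m" and ?i = "inv_into (positions m) \<phi>"
  let ?G = "cartesian_power m cycle4" and ?V = "verts (hypercube (2 * m))" and ?F = "\<lambda>u. A (inv_into (positions m) \<phi> u)"
  have bij: "bij_betw \<phi> ?X ?V" using iso by (simp add: graph_iso_def verts_grid)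
  have bi: "bij_betw ?i ?V ?X" using bij by (rule bij_betw_inv_into)
  have iso': "graph_iso (hypercube ?n) ?G ?i" using graph_iso_inv[OF iso] by (simp add: verts_grid)
  have sum: "sum A (?i ` T) = sum ?F T" if "T \<subseteq> ?V" for T
    using inj_on_subset[OF bij_betw_imp_inj_on[OF bi] that] by (simp add: sum.reindex)
  have "bij_betw A ?X {1..4 ^ m} \<longleftrightarrow> bij_betw ?F ?V {1..2 ^ ?n}"
    using bij_betw_comp_iff[OF bi, of A "{1..4 ^ m}"] by (simp add: o_def power_mult)
  moreover have "(\<forall>S\<in>orthogonal_lines m \<union> subsquares m. sum A S = c) \<longleftrightarrow>
      (\<forall>x i j. i < ?n \<and> j < ?n \<and> i \<noteq> j \<longrightarrow> face_sum ?n (\<lambda>u. real (?F u)) i j x = real c)" for c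
  proof -
    have "(\<forall>S\<in>orthogonal_lines m \<union> subsquares m. sum A S = c) \<longleftrightarrow> (\<forall>S. four_cycle ?G S \<longrightarrow> sum A S = c)"
      by (simp only: four_cycle_grid Ball_def)
    also have "\<dots> \<longleftrightarrow> (\<forall>T. four_cycle (hypercube ?n) T \<longrightarrow> sum ?F T = c)"
    proof (intro iffI allI impI)
      fix T assume *: "\<forall>S. four_cycle ?G S \<longrightarrow> sum A S = c" and T: "four_cycle (hypercube ?n) T"
      then show "sum ?F T = c" using four_cycle_iso_image[OF iso' T] sum[OF four_cycle_subset[OF T]] by simp
    next
      fix S assume *: "\<forall>T. four_cycle (hypercube ?n) T \<longrightarrow> sum ?F T = c" and S: "four_cycle ?G S"
      have "S \<subseteq> ?X" using four_cycle_subset[OF S] by (simp add: verts_grid)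
      then have "?i ` \<phi> ` S = S" using bij by (meson bij_betw_imp_inj_on inv_into_image_cancel)
      then show "sum A S = c"
        using * four_cycle_iso_image[OF iso S] sum[OF four_cycle_subset[OF four_cycle_iso_image[OF iso S]]] by metis
    qed
    also have "\<dots> \<longleftrightarrow> (\<forall>x i j. i < ?n \<and> j < ?n \<and> i \<noteq> j \<longrightarrow>
        sum ?F {cls ?n x, cls ?n (flip i x), cls ?n (flip i (flip j x)), cls ?n (flip j x)} = c)"
      unfolding four_cycle_hypercube by blast
    also have "\<dots> \<longleftrightarrow> (\<forall>x i j. i < ?n \<and> j < ?n \<and> i \<noteq> j \<longrightarrow> face_sum ?n (\<lambda>u. real (?F u)) i j x = real c)"
    proof (intro all_cong1 imp_cong refl)
      fix x i j assume "i < ?n \<and> j < ?n \<and> i \<noteq> j"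
      then have "face_sum ?n (\<lambda>u. real (?F u)) i j x =
        real (sum ?F {cls ?n x, cls ?n (flip i x), cls ?n (flip i (flip j x)), cls ?n (flip j x)})"
        unfolding of_nat_sum by (intro sum_face[symmetric]) auto
      then show "(sum ?F {cls ?n x, cls ?n (flip i x), cls ?n (flip i (flip j x)), cls ?n (flip j x)} = c) =
        (face_sum ?n (\<lambda>u. real (?F u)) i j x = real c)" by (simp only: of_nat_eq_iff)
    qed
    finally show ?thesis .
  qed
  ultimately show ?thesis
    unfolding compact_magic_hypercubes_def arrangements_def face_magic_def by auto
qed

section \<open>The action on arrangements\<close>

text \<open>\<open>Aut\<close> is the group of all bijections with a smaller carrier. Knowing this
  carrier to be a subgroup gives the group axioms and the agreement of inverses at once.\<close>

lemma subgroup_graph_auts: "subgroup {f \<in> Bij (verts G). graph_iso G G f} (BijGroup (verts G))"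
proof (rule group.subgroupI[OF group_BijGroup])
  let ?V = "verts G"
  show "{f \<in> Bij ?V. graph_iso G G f} \<subseteq> carrier (BijGroup ?V)" by (auto simp: BijGroup_def)
  have "graph_iso G G (\<lambda>x\<in>?V. x)" by (auto simp: graph_iso_def bij_betw_def inj_on_def)
  then show "{f \<in> Bij ?V. graph_iso G G f} \<noteq> {}" using id_Bij by blast
  show "inv\<^bsub>BijGroup ?V\<^esub> f \<in> {f \<in> Bij ?V. graph_iso G G f}"
    if f: "f \<in> {f \<in> Bij ?V. graph_iso G G f}" for f
  proof -
    have "graph_iso G G (inv_into ?V f)" using graph_iso_inv f by blast
    then have "graph_iso G G (\<lambda>x\<in>?V. inv_into ?V f x)"
      by (simp add: graph_iso_def cong: bij_betw_cong)
    then show ?thesis using f restrict_inv_into_Bij[of f ?V] by (simp add: inv_BijGroup)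
  qed
  show "f \<otimes>\<^bsub>BijGroup ?V\<^esub> g \<in> {f \<in> Bij ?V. graph_iso G G f}"
    if f: "f \<in> {f \<in> Bij ?V. graph_iso G G f}" and g: "g \<in> {f \<in> Bij ?V. graph_iso G G f}" for f g
  proof -
    have fg: "compose ?V f g \<in> Bij ?V" using f g compose_Bij by blast
    have gV: "g u \<in> ?V" if "u \<in> ?V" for u using g that bij_betw_apply[of g ?V ?V u] by (simp add: Bij_def)
    have "graph_iso G G (compose ?V f g)"
      unfolding graph_iso_def
    proof (intro conjI ballI)
      show "bij_betw (compose ?V f g) ?V ?V" using fg by (simp add: Bij_def)
      fix u v assume "u \<in> ?V" "v \<in> ?V"
      then show "{u, v} \<in> edges G \<longleftrightarrow> {compose ?V f g u, compose ?V f g v} \<in> edges G"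
        using f g gV by (simp add: compose_eq graph_iso_def)
    qed
    then show ?thesis using f g fg by (simp add: BijGroup_def)
  qed
qed

lemma group_Aut: "group (Aut G)"
  unfolding Aut_def by (rule subgroup.subgroup_is_group[OF subgroup_graph_auts group_BijGroup])

lemma inv_Aut: "g \<in> carrier (Aut G) \<Longrightarrow> inv\<^bsub>Aut G\<^esub> g = (\<lambda>u\<in>verts G. inv_into (verts G) g u)"
  using group.m_inv_consistent[OF group_BijGroup subgroup_graph_auts, of g G]
  by (simp add: Aut_def inv_BijGroup)

text \<open>\<open>\<phi>\<close> is an isomorphism onto the hypercube, while the acting group is
  that of the folded hypercube. What the two graphs share is the vertex set, so the action is
  studied for a bijection onto the vertices of a graph \<open>G\<close>.\<close>

locale vertex_labelling =
  fixes m :: nat and G :: "(nat \<Rightarrow> nat) ugraph" and \<phi>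
  assumes bij: "bij_betw \<phi> (positions m) (verts G)"
begin

abbreviation "place \<equiv> inv_into (positions m) \<phi>"

lemma bij_place: "bij_betw place (verts G) (positions m)"
  using bij by (rule bij_betw_inv_into)

lemma place_in: "u \<in> verts G \<Longrightarrow> place u \<in> positions m"
  using bij_betw_apply[OF bij_place, of u] by simp

lemma phi_place: "u \<in> verts G \<Longrightarrow> \<phi> (place u) = u"
  using bij by (rule bij_betw_inv_into_right)

lemma place_cases:
  assumes "p \<in> positions m"
  obtains u where "u \<in> verts G" "p = place u"
  using assms bij_place unfolding bij_betw_def by blast

lemma Aut_bij: "g \<in> carrier (Aut G) \<Longrightarrow> bij_betw g (verts G) (verts G)"
  by (simp add: Aut_carrier Bij_def)

lemma Aut_in: "g \<in> carrier (Aut G) \<Longrightarrow> u \<in> verts G \<Longrightarrow> g u \<in> verts G"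
  using bij_betw_apply[OF Aut_bij, of g u] by simp

lemma Aut_preimage:
  assumes "g \<in> carrier (Aut G)" "u \<in> verts G"
  obtains v where "v \<in> verts G" "u = g v"
  using assms Aut_bij unfolding bij_betw_def by blast

lemma position_perm_place: "u \<in> verts G \<Longrightarrow> position_perm m \<phi> g (place u) = place (g u)"
  by (simp add: position_perm_def place_in phi_place)

lemma inj_position_perm:
  assumes "g \<in> carrier (Aut G)"
  shows "inj_on (position_perm m \<phi> g) (positions m)"
proof (rule inj_onI)
  fix p q assume "p \<in> positions m" "q \<in> positions m" and eq: "position_perm m \<phi> g p = position_perm m \<phi> g q"
  then obtain u v where u: "u \<in> verts G" "p = place u" and v: "v \<in> verts G" "q = place v"
    by (metis place_cases)
  have "\<phi> (place (g u)) = \<phi> (place (g v))" using eq u v by (simp add: position_perm_place)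
  then have "g u = g v" using Aut_in[OF assms] u v by (simp add: phi_place)
  then show "p = q" using Aut_bij[OF assms] u v by (auto simp: bij_betw_def inj_on_def)
qed

text \<open>The entry at vertex \<open>u\<close> travels to \<open>g u\<close>. In this form the
  action is free of the inverse of \<open>position_perm\<close>, and since every vertex is some
  \<open>g u\<close>, the equation determines the new arrangement.\<close>

lemma action_place:
  assumes "g \<in> carrier (Aut G)" "A \<in> E" "u \<in> verts G"
  shows "arrangement_action m \<phi> E g A (place (g u)) = A (place u)"
proof -
  have "inv_into (positions m) (position_perm m \<phi> g) (place (g u)) = place u"
    using assms by (intro inv_into_f_eq inj_position_perm place_in position_perm_place)
  then show ?thesis using assms by (simp add: arrangement_action_def place_in Aut_in)
qed

lemma action_extensional:
  "A \<in> E \<Longrightarrow> arrangement_action m \<phi> E g A \<in> extensional (positions m)"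
  by (simp add: arrangement_action_def)

lemma action_eqI:
  assumes g: "g \<in> carrier (Aut G)" and A: "A \<in> E" and B: "B \<in> extensional (positions m)"
    and eq: "\<And>u. u \<in> verts G \<Longrightarrow> B (place (g u)) = A (place u)"
  shows "arrangement_action m \<phi> E g A = B"
proof (rule extensionalityI[OF action_extensional[OF A] B])
  fix p assume "p \<in> positions m"
  then obtain u where u: "u \<in> verts G" "p = place u" by (rule place_cases)
  obtain v where v: "v \<in> verts G" "u = g v" using Aut_preimage[OF g u(1)] .
  then show "arrangement_action m \<phi> E g A p = B p" using u action_place[OF g A v(1)] eq[OF v(1)] by simp
qed

text \<open>Faithfulness can be seen on a single arrangement: its entries are pairwise different, so
  the place to which each entry moves reveals \<open>g\<close> vertex by vertex.\<close>

lemma faithful_action_if_closed: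
  assumes ext: "\<And>A. A \<in> E \<Longrightarrow> A \<in> extensional (positions m)"
    and inj: "\<And>A. A \<in> E \<Longrightarrow> inj_on A (positions m)" and ne: "E \<noteq> {}"
    and closed: "\<And>g A. g \<in> carrier (Aut G) \<Longrightarrow> A \<in> E \<Longrightarrow> arrangement_action m \<phi> E g A \<in> E"
  shows "faithful_action (Aut G) E (arrangement_action m \<phi> E)"
proof -
  let ?act = "arrangement_action m \<phi> E"
  interpret Aut: group "Aut G" by (rule group_Aut)
  have mult: "g \<otimes>\<^bsub>Aut G\<^esub> h = compose (verts G) g h" if "g \<in> carrier (Aut G)" "h \<in> carrier (Aut G)" for g h
    using that by (simp add: Aut_def BijGroup_def)
  have act_mult: "?act (g \<otimes>\<^bsub>Aut G\<^esub> h) A = ?act g (?act h A)"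
    if gh: "g \<in> carrier (Aut G)" "h \<in> carrier (Aut G)" and A: "A \<in> E" for g h A
  proof (rule action_eqI)
    fix u assume u: "u \<in> verts G"
    have "?act g (?act h A) (place (g (h u))) = A (place u)"
      using action_place[OF gh(1) closed[OF gh(2) A] Aut_in[OF gh(2) u]] action_place[OF gh(2) A u] by simp
    then show "?act g (?act h A) (place ((g \<otimes>\<^bsub>Aut G\<^esub> h) u)) = A (place u)"
      using u by (simp add: mult gh compose_eq)
  qed (use gh A closed action_extensional in auto)
  have one: "\<one>\<^bsub>Aut G\<^esub> u = u" if "u \<in> verts G" for u using that by (simp add: Aut_def BijGroup_def)
  have act_one: "?act \<one>\<^bsub>Aut G\<^esub> A = A" if "A \<in> E" for A
    using that ext by (intro action_eqI) (simp_all add: one)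
  have inBij: "?act g \<in> Bij E" if g: "g \<in> carrier (Aut G)" for g
  proof -
    have ig: "inv\<^bsub>Aut G\<^esub> g \<in> carrier (Aut G)" using g by simp
    have "bij_betw (?act g) E E"
      by (rule bij_betw_byWitness[of _ "?act (inv\<^bsub>Aut G\<^esub> g)"])
        (use g ig closed act_one in \<open>auto simp flip: act_mult\<close>)
    then show ?thesis by (simp add: Bij_def arrangement_action_def)
  qed
  have "?act \<in> hom (Aut G) (BijGroup E)"
  proof (rule homI)
    show "?act g \<in> carrier (BijGroup E)" if "g \<in> carrier (Aut G)" for g
      using inBij[OF that] by (simp add: BijGroup_def)
    fix g h assume gh: "g \<in> carrier (Aut G)" "h \<in> carrier (Aut G)"
    have "?act (g \<otimes>\<^bsub>Aut G\<^esub> h) = compose E (?act g) (?act h)"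
    proof (rule extensionalityI[of _ E])
      show "?act (g \<otimes>\<^bsub>Aut G\<^esub> h) \<in> extensional E" by (simp add: arrangement_action_def)
    qed (simp_all add: compose_eq act_mult gh)
    then show "?act (g \<otimes>\<^bsub>Aut G\<^esub> h) = ?act g \<otimes>\<^bsub>BijGroup E\<^esub> ?act h"
      using inBij gh by (simp add: BijGroup_def)
  qed
  then have "group_hom (Aut G) (BijGroup E) ?act"
    by (simp add: group_hom_def group_hom_axioms_def group_Aut group_BijGroup)
  moreover have "inj_on ?act (carrier (Aut G))"
  proof (rule inj_onI)
    fix g h assume g: "g \<in> carrier (Aut G)" and h: "h \<in> carrier (Aut G)" and eq: "?act g = ?act h"
    obtain A where A: "A \<in> E" using ne by blast
    show "g = h"
    proof (rule extensionalityI[of _ "verts G"])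
      fix u assume u: "u \<in> verts G"
      obtain v where v: "v \<in> verts G" "g u = h v" using Aut_preimage[OF h Aut_in[OF g u]] .
      have "A (place u) = A (place v)"
        using action_place[OF g A u] action_place[OF h A v(1)] eq v(2) by simp
      then have "place u = place v" using inj_onD[OF inj[OF A]] place_in u v by blast
      then have "u = v" using phi_place u v by metis
      then show "g u = h u" using v by simp
    qed (use g h in \<open>simp_all add: Aut_carrier Bij_def\<close>)
  qed
  ultimately show ?thesis
    by (simp add: faithful_action_def group_action_def faithful_action_axioms_def)
qed

end

theorem theorem9:
  fixes m :: nat and \<phi> :: "(nat \<Rightarrow> nat) \<Rightarrow> (nat \<Rightarrow> nat)"
  assumes "m \<ge> 1"
    and "graph_iso (cartesian_power m cycle4) (hypercube (2 * m)) \<phi>"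
  shows "Aut (folded_hypercube (2 * m)) \<cong> C2_semidirect_Sym m \<and>
    faithful_action (Aut (folded_hypercube (2 * m))) (arrangements m)
      (arrangement_action m \<phi> (arrangements m)) \<and>
    faithful_action (Aut (folded_hypercube (2 * m))) (compact_magic_hypercubes m)
      (arrangement_action m \<phi> (compact_magic_hypercubes m)) \<and>
    compact_magic_hypercubes m \<noteq> {} \<and>
    orbits (Aut (folded_hypercube (2 * m))) (compact_magic_hypercubes m)
      (arrangement_action m \<phi> (compact_magic_hypercubes m)) =
      {compact_magic_hypercubes m}"
proof -
  let ?n = "2 * m" and ?X = "positions m"
  let ?A = "Aut (folded_hypercube ?n)" and ?V = "verts (hypercube ?n)"
  let ?C = "compact_magic_hypercubes m"
  have n: "even ?n" "?n \<ge> 2" using assms(1) by auto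
  interpret vertex_labelling m "folded_hypercube ?n" \<phi>
    using assms(2) by unfold_locales (simp add: graph_iso_def verts_grid)
  interpret Aut: group ?A by (rule group_Aut)
  note C_iff = compact_magic_hypercubes_iff[OF assms(2)]
  have C_arr: "?C \<subseteq> arrangements m" by (auto simp: compact_magic_hypercubes_def)
  have arr_inj: "inj_on B ?X" if "B \<in> arrangements m" for B
    using that by (simp add: arrangements_def bij_betw_def)
  have ginv: "g ((inv\<^bsub>?A\<^esub> g) u) = u" if "g \<in> carrier ?A" "u \<in> ?V" for g u
    using that Aut_bij[of g] bij_betw_inv_into_right[of g ?V ?V u] by (simp add: inv_Aut)
  \<comment> \<open>Seen from the target vertex, \<open>g\<close> acts by precomposition with its
    inverse; this is the shape to which \<open>face_magic_Aut\<close> applies.\<close>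
  have act_inv: "arrangement_action m \<phi> E g B (place u) = B (place ((inv\<^bsub>?A\<^esub> g) u))"
    if "g \<in> carrier ?A" "B \<in> E" "u \<in> ?V" for g B E u
    using action_place[of g B E "(inv\<^bsub>?A\<^esub> g) u"] that ginv[OF that(1,3)]
      Aut_in[of "inv\<^bsub>?A\<^esub> g" u] Aut.inv_closed[OF that(1)] by simp
  have "\<exists>F. F \<in> face_magic ?n" using face_magic_nonempty[OF n(1)] by blast
  then obtain F where F: "F \<in> face_magic ?n" ..
  define A0 where "A0 = (\<lambda>p\<in>?X. F (\<phi> p))"
  have A0: "A0 (place u) = F u" if "u \<in> ?V" for u
    using that by (simp add: A0_def place_in phi_place)
  \<comment> \<open>\<open>A0\<close> read on the cube agrees with \<open>F\<close> on vertices
    only, so the two functions need not be equal; membership is regained through the common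
    symmetric form.\<close>
  have "(\<lambda>u. A0 (place u)) \<in> face_magic ?n"
  proof -
    obtain b where "\<And>x. real (F (cls ?n x)) = (2 ^ ?n + 1) / 2 + amp ?n b x"
      using face_magic_amp[OF n F] by blast
    moreover have "bij_betw (\<lambda>u. A0 (place u)) ?V {1..2 ^ ?n}"
      using F A0 by (simp add: face_magic_def cong: bij_betw_cong)
    ultimately show ?thesis using A0 by (intro face_magicI) auto
  qed
  then have "A0 \<in> ?C" unfolding C_iff by (simp add: A0_def)
  then have ne: "?C \<noteq> {}" by blast
  have closedC: "arrangement_action m \<phi> ?C g B \<in> ?C" if g: "g \<in> carrier ?A" and B: "B \<in> ?C" for g B
  proof -
    let ?B' = "arrangement_action m \<phi> ?C g B"
    have "(\<lambda>u. B (place ((inv\<^bsub>?A\<^esub> g) u))) \<in> face_magic ?n"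
      using face_magic_Aut[OF n _ Aut.inv_closed[OF g], of "\<lambda>u. B (place u)"] B unfolding C_iff by blast
    then obtain b where b: "\<And>x. real (B (place ((inv\<^bsub>?A\<^esub> g) (cls ?n x)))) = (2 ^ ?n + 1) / 2 + amp ?n b x"
      and bij: "bij_betw (\<lambda>u. B (place ((inv\<^bsub>?A\<^esub> g) u))) ?V {1..2 ^ ?n}"
      using face_magic_amp[OF n] unfolding face_magic_def by blast
    have "(\<lambda>u. ?B' (place u)) \<in> face_magic ?n"
      using b bij act_inv[OF g B] by (intro face_magicI) (simp_all cong: bij_betw_cong)
    then show ?thesis unfolding C_iff using action_extensional[OF B] by simp
  qed
  have closedA: "arrangement_action m \<phi> (arrangements m) g B \<in> arrangements m"
    if g: "g \<in> carrier ?A" and B: "B \<in> arrangements m" for g B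
  proof -
    let ?B' = "arrangement_action m \<phi> (arrangements m) g B"
    have "bij_betw (B \<circ> place \<circ> (inv\<^bsub>?A\<^esub> g)) ?V {1..4 ^ m}"
      using B bij_place Aut_bij[OF Aut.inv_closed[OF g]]
      by (auto simp: arrangements_def intro!: bij_betw_trans)
    then have "bij_betw (?B' \<circ> place) ?V {1..4 ^ m}"
      using act_inv[OF g B] by (simp cong: bij_betw_cong)
    then have "bij_betw ?B' ?X {1..4 ^ m}"
      using bij_betw_comp_iff[OF bij_place, of ?B'] by simp
    then show ?thesis using action_extensional[OF B] by (simp add: arrangements_def)
  qed
  have faithfulA: "faithful_action ?A (arrangements m) (arrangement_action m \<phi> (arrangements m))"
    by (rule faithful_action_if_closed) (use arr_inj ne C_arr closedA in \<open>auto simp: arrangements_def\<close>)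
  have faithfulC: "faithful_action ?A ?C (arrangement_action m \<phi> ?C)"
    by (rule faithful_action_if_closed) (use arr_inj ne C_arr closedC in \<open>auto simp: arrangements_def\<close>)
  have "orbit ?A (arrangement_action m \<phi> ?C) B = ?C" if B: "B \<in> ?C" for B
  proof (intro equalityI subsetI)
    fix B' assume "B' \<in> orbit ?A (arrangement_action m \<phi> ?C) B"
    then show "B' \<in> ?C" using closedC B unfolding orbit_def by blast
  next
    fix B' assume B': "B' \<in> ?C"
    \<comment> \<open>The roles of \<open>B\<close> and \<open>B'\<close> are exchanged here: moving
      entries along \<open>g\<close> puts the entry of \<open>B\<close> at \<open>u\<close> onto
      \<open>g u\<close>, so \<open>B\<close> has to be expressed through \<open>B'\<close> composed
      with \<open>g\<close>.\<close>
    obtain g where g: "g \<in> carrier ?A" "\<And>u. u \<in> ?V \<Longrightarrow> B (place u) = B' (place (g u))"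
      using face_magic_transitive[OF n, of "\<lambda>u. B' (place u)" "\<lambda>u. B (place u)"] B B' unfolding C_iff by blast
    have "arrangement_action m \<phi> ?C g B = B'"
      using g B B' by (intro action_eqI) (simp_all add: C_iff)
    then show "B' \<in> orbit ?A (arrangement_action m \<phi> ?C) B" using g(1) unfolding orbit_def by blast
  qed
  then have "orbits ?A ?C (arrangement_action m \<phi> ?C) = {?C}" using ne unfolding orbits_def by auto
  then show ?thesis
    using Aut_folded_hypercube_iso[OF assms(1)] faithfulA faithfulC ne by blast
qed

end
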